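(* Suppose the functions $L_{ij}$, $(i,j)\in E$, satisfy: $L_{ij}(a)=L_{ji}(a)$, $L_{ij}(-a)=L_{ij}(a)$, $L_{ij}(0)=0$ for all $a\in\mathbb R$, and each $L_{ij}$ is strictly convex and coercive (superlinear). Let $H_{ij}$ be the convex conjugate of $L_{ij}$. Consider the variational problem $$\mathcal U(p,t)=\sup_{v_s,p_s}\Big\{\mathcal G(p_T)-\int_t^T\Big(\tfrac12\sum_{(i,j)\in E}\theta_{ij}(p_s)L_{ij}(v_s(ij))-\mathcal F(p_s)\Big)ds\Big\}$$ subject to $\frac{dp_s(i)}{ds}+\sum_{j\in\mathcal N_i}\sqrt{\omega_{ij}}\,\theta_{ij}(p_s)v_s(ij)=0$, $v_s(ij)=-v_s(ji)$, $t\le s\le T$, $p_t(i)=p_i$. Assume $p_s>0$ (componentwise) for $t\le s\le T$. Then the Euler–Lagrange equations of this problem, with $\Phi_s=(\Phi_s(i))_{i=1}^n$ the Lagrange multiplier of the continuity equation, are that $(p_s,\Phi_s)$, $t\le s\le T$, satisfies $$\frac{dp_s(i)}{ds}+\sum_{j\in\mathcal N_i}\sqrt{\omega_{ij}}\,\theta_{ij}(p_s)\,H'_{ij}\big((\overline\nabla_\omega\Phi_s)_{i,j}\big)=0,$$ $$\frac{d\Phi_s(i)}{ds}+\sum_{j\in\mathcal N_i}H_{ij}\big((\overline\nabla_\omega\Phi_s)_{i,j}\big)\frac{\partial\theta_{ij}}{\partial p_i}(p_s)+\frac{\partial}{\partial p_i}\mathcal F(p_s)=0,$$ for $t\le s\le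 T$ and $i=1,\dots,n$, with $$p_t(i)=p_i,\qquad \Phi_T(i)=\frac{\partial}{\partial p_T(i)}\mathcal G(p_T).$$ Additionally, the optimal velocity is given by the feedback control $$v_s(ij)=H'_{ij}\big((\overline\nabla_\omega\Phi_s)_{i,j}\big),\qquad (i,j)\in E.$$
   Context: $\mathcal X=\{1,\dots,n\}$ and $\mathcal P(\mathcal X)=\{p\in\mathbb R^n:\ p_i\ge0,\ \sum_ip_i=1\}$. $Q$ is the generator of a reversible continuous-time Markov chain on $\mathcal X$ ($Q_{ij}\ge0$ for $j\ne i$, zero row sums) with unique positive invariant measure $\pi$ satisfying $Q_{ij}\pi_i=Q_{ji}\pi_j$. Put $\omega_{ij}=Q_{ij}\pi_i$, $E=\{(i,j):i\ne j,\ \omega_{ij}>0\}$, $\mathcal N_i=\{j:(i,j)\in E\}$, and $(\overline\nabla_\omega\Phi)_{i,j}=\sqrt{\omega_{ij}}(\Phi_j-\Phi_i)$ for $\Phi\in\mathbb R^n$, $(i,j)\in E$. The activation function $\theta:\mathbb R^+\times\mathbb R^+\to\mathbb R^+$ satisfies (i) $\theta(x,y)=\theta(y,x)$; (ii) $\theta(x,y)>0$ if $xy\ne0$; (iii) $\theta\in C^1$; (iv) $\theta(x,y)=0$ if $xy=0$; and $\theta_{ij}(p)=\theta(p_i/\pi_i,p_j/\pi_j)$. $\mathcal F,\mathcal G\in C^1(\mathcal P(\mathcal X))$, treated as $C^1$ functions of the $n$ coordinates so that $\partial/\partial p_i$ makes sense. The supremum is over continuously differentiable $p_s\in\mathcal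 P(\mathcal X)$ and antisymmetric vector fields $v_s$, $s\in[t,T]$. The convex conjugate is $H_{ij}(b)=\sup_{a\in\mathbb R}(ab-L_{ij}(a))$. The Euler–Lagrange equations are the stationarity conditions, with respect to $v_s$, $p_s$, $p_T$, $\Phi_s$, of the functional $$\mathcal G(p_T)-\int_t^T\Big(\tfrac12\sum_{(i,j)\in E}L_{ij}(v_s(ij))\theta_{ij}(p_s)-\mathcal F(p_s)\Big)ds-\int_t^T\sum_{i=1}^n\Phi_s(i)\Big[\frac{dp_s(i)}{ds}+\sum_{j\in\mathcal N_i}\sqrt{\omega_{ij}}v_s(ij)\theta_{ij}(p_s)\Big]ds .$$ *)

theory Defs
  imports "HOL-Analysis.Analysis"
begin

section \<open>Reversible Markov chains on a finite state space\<close>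

definition prob_simplex :: "(real^'n) set" where
  "prob_simplex = {p. (\<forall>i. 0 \<le> p $ i) \<and> (\<Sum>i\<in>UNIV. p $ i) = 1}"

definition generator :: "real^'n^'n \<Rightarrow> bool" where
  "generator Q \<longleftrightarrow> (\<forall>i j. i \<noteq> j \<longrightarrow> 0 \<le> Q $ i $ j) \<and> (\<forall>i. (\<Sum>j\<in>UNIV. Q $ i $ j) = 0)"

definition positive_invariant :: "real^'n^'n \<Rightarrow> real^'n \<Rightarrow> bool" where
  "positive_invariant Q \<mu> \<longleftrightarrow> \<mu> \<in> prob_simplex \<and> (\<forall>i. 0 < \<mu> $ i) \<and> \<mu> v* Q = 0"

definition reversible_chain :: "real^'n^'n \<Rightarrow> real^'n \<Rightarrow> bool" where
  "reversible_chain Q \<pi> \<longleftrightarrow>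
     generator Q \<and>
     positive_invariant Q \<pi> \<and> (\<forall>\<mu>. positive_invariant Q \<mu> \<longrightarrow> \<mu> = \<pi>) \<and>
     (\<forall>i j. Q $ i $ j * \<pi> $ i = Q $ j $ i * \<pi> $ j)"

definition weight :: "real^'n^'n \<Rightarrow> real^'n \<Rightarrow> 'n \<Rightarrow> 'n \<Rightarrow> real" where
  "weight Q \<pi> i j = Q $ i $ j * \<pi> $ i"

definition edges :: "('n \<Rightarrow> 'n \<Rightarrow> real) \<Rightarrow> ('n \<times> 'n) set" where
  "edges \<omega> = {(i, j). i \<noteq> j \<and> 0 < \<omega> i j}"

definition nbrs :: "('n \<Rightarrow> 'n \<Rightarrow> real) \<Rightarrow> 'n \<Rightarrow> 'n set" where
  "nbrs \<omega> i = {j. (i, j) \<in> edges \<omega>}"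

definition graph_grad :: "('n \<Rightarrow> 'n \<Rightarrow> real) \<Rightarrow> real^'n \<Rightarrow> 'n \<Rightarrow> 'n \<Rightarrow> real" where
  "graph_grad \<omega> \<Phi> i j = sqrt (\<omega> i j) * (\<Phi> $ j - \<Phi> $ i)"


section \<open>Continuously differentiable functions and curves\<close>

definition C1_on :: "'a::real_normed_vector set \<Rightarrow> ('a \<Rightarrow> real) \<Rightarrow> bool" where
  "C1_on U f \<longleftrightarrow> open U \<and>
     (\<exists>f' :: 'a \<Rightarrow> 'a \<Rightarrow>\<^sub>L real.
        (\<forall>x\<in>U. (f has_derivative blinfun_apply (f' x)) (at x)) \<and> continuous_on U f')"

text \<open>Functions on the simplex are differentiated in all \<open>n\<close> coordinates, so they are given on
  an open neighbourhood of it in the ambient space.\<close>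

definition C1_simplex :: "(real^'n \<Rightarrow> real) \<Rightarrow> bool" where
  "C1_simplex f \<longleftrightarrow> (\<exists>U. prob_simplex \<subseteq> U \<and> C1_on U f)"

definition partial_deriv :: "'n \<Rightarrow> (real^'n \<Rightarrow> real) \<Rightarrow> real^'n \<Rightarrow> real" where
  "partial_deriv i f x = deriv (\<lambda>h. f (x + h *\<^sub>R axis i 1)) 0"

definition C1_curve :: "real \<Rightarrow> real \<Rightarrow> (real \<Rightarrow> real^'n) \<Rightarrow> bool" where
  "C1_curve t T c \<longleftrightarrow>
     (\<exists>c'. (\<forall>s\<in>{t..T}. (c has_vector_derivative c' s) (at s within {t..T})) \<and>
           continuous_on {t..T} c')"


section \<open>Activation functions, Lagrangians and Hamiltonians\<close>

text \<open>Differentiability is required in the open quadrant only: typical activation functions, such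
  as the logarithmic mean, are not \<open>C\<^sup>1\<close> up to the axes.\<close>

definition activation :: "(real \<Rightarrow> real \<Rightarrow> real) \<Rightarrow> bool" where
  "activation \<theta> \<longleftrightarrow>
     (\<forall>x\<ge>0. \<forall>y\<ge>0. 0 \<le> \<theta> x y \<and> \<theta> x y = \<theta> y x \<and>
        (x * y \<noteq> 0 \<longrightarrow> 0 < \<theta> x y) \<and> (x * y = 0 \<longrightarrow> \<theta> x y = 0)) \<and>
     continuous_on ({0..} \<times> {0..}) (\<lambda>(x, y). \<theta> x y) \<and>
     C1_on ({0<..} \<times> {0<..}) (\<lambda>(x, y). \<theta> x y)"

definition edge_activation ::
    "(real \<Rightarrow> real \<Rightarrow> real) \<Rightarrow> real^'n \<Rightarrow> 'n \<Rightarrow> 'n \<Rightarrow> real^'n \<Rightarrow> real" where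
  "edge_activation \<theta> \<pi> i j p = \<theta> (p $ i / \<pi> $ i) (p $ j / \<pi> $ j)"

definition strictly_convex :: "(real \<Rightarrow> real) \<Rightarrow> bool" where
  "strictly_convex f \<longleftrightarrow>
     (\<forall>a b u. a \<noteq> b \<longrightarrow> 0 < u \<longrightarrow> u < 1 \<longrightarrow> f (u * a + (1 - u) * b) < u * f a + (1 - u) * f b)"

definition superlinear :: "(real \<Rightarrow> real) \<Rightarrow> bool" where
  "superlinear f \<longleftrightarrow> filterlim (\<lambda>a. f a / \<bar>a\<bar>) at_top at_infinity"

definition edge_lagrangians :: "('n \<times> 'n) set \<Rightarrow> ('n \<Rightarrow> 'n \<Rightarrow> real \<Rightarrow> real) \<Rightarrow> bool" where
  "edge_lagrangians E L \<longleftrightarrow>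
     (\<forall>(i, j)\<in>E. (\<forall>a. L i j a = L j i a \<and> L i j (- a) = L i j a) \<and> L i j 0 = 0 \<and>
        strictly_convex (L i j) \<and> superlinear (L i j))"

text \<open>A real supremum; the set is bounded above when \<open>f\<close> is convex and superlinear.\<close>

definition convex_conjugate :: "(real \<Rightarrow> real) \<Rightarrow> real \<Rightarrow> real" where
  "convex_conjugate f b = (SUP a. a * b - f a)"


section \<open>The variational problem\<close>

text \<open>In this section \<open>\<omega>\<close> is the edge weight and \<open>\<Theta> i j p\<close> the edge activation.
  Only the values of a velocity field on the edges matter.\<close>

definition velocity_field ::
    "('n \<Rightarrow> 'n \<Rightarrow> real) \<Rightarrow> real \<Rightarrow> real \<Rightarrow> (real \<Rightarrow> 'n \<Rightarrow> 'n \<Rightarrow> real) \<Rightarrow> bool" where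
  "velocity_field \<omega> t T v \<longleftrightarrow>
     (\<forall>(i, j)\<in>edges \<omega>. continuous_on {t..T} (\<lambda>s. v s i j) \<and> (\<forall>s\<in>{t..T}. v s i j = - v s j i))"

definition simplex_curve :: "real \<Rightarrow> real \<Rightarrow> (real \<Rightarrow> real^'n) \<Rightarrow> bool" where
  "simplex_curve t T p \<longleftrightarrow> C1_curve t T p \<and> (\<forall>s\<in>{t..T}. p s \<in> prob_simplex)"

definition continuity_residual ::
    "('n \<Rightarrow> 'n \<Rightarrow> real) \<Rightarrow> ('n \<Rightarrow> 'n \<Rightarrow> real^'n \<Rightarrow> real) \<Rightarrow> real \<Rightarrow> real \<Rightarrow>
     (real \<Rightarrow> real^'n) \<Rightarrow> (real \<Rightarrow> 'n \<Rightarrow> 'n \<Rightarrow> real) \<Rightarrow> real \<Rightarrow> 'n \<Rightarrow> real" where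
  "continuity_residual \<omega> \<Theta> t T p v s i =
     vector_derivative (\<lambda>r. p r $ i) (at s within {t..T}) +
     (\<Sum>j\<in>nbrs \<omega> i. sqrt (\<omega> i j) * v s i j * \<Theta> i j (p s))"

definition admissible ::
    "('n \<Rightarrow> 'n \<Rightarrow> real) \<Rightarrow> ('n \<Rightarrow> 'n \<Rightarrow> real^'n \<Rightarrow> real) \<Rightarrow> real \<Rightarrow> real \<Rightarrow> real^'n \<Rightarrow>
     ((real \<Rightarrow> real^'n) \<times> (real \<Rightarrow> 'n \<Rightarrow> 'n \<Rightarrow> real)) set" where
  "admissible \<omega> \<Theta> t T p0 =
     {(p, v). simplex_curve t T p \<and> velocity_field \<omega> t T v \<and> p t = p0 \<and>
        (\<forall>s\<in>{t..T}. \<forall>i. continuity_residual \<omega> \<Theta> t T p v s i = 0)}"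

definition objective ::
    "('n \<Rightarrow> 'n \<Rightarrow> real) \<Rightarrow> ('n \<Rightarrow> 'n \<Rightarrow> real^'n \<Rightarrow> real) \<Rightarrow> ('n \<Rightarrow> 'n \<Rightarrow> real \<Rightarrow> real) \<Rightarrow>
     (real^'n \<Rightarrow> real) \<Rightarrow> (real^'n \<Rightarrow> real) \<Rightarrow> real \<Rightarrow> real \<Rightarrow>
     (real \<Rightarrow> real^'n) \<Rightarrow> (real \<Rightarrow> 'n \<Rightarrow> 'n \<Rightarrow> real) \<Rightarrow> real" where
  "objective \<omega> \<Theta> L F G t T p v =
     G (p T) -
     integral {t..T} (\<lambda>s. 1/2 * (\<Sum>(i, j)\<in>edges \<omega>. \<Theta> i j (p s) * L i j (v s i j)) - F (p s))"

definition value_function ::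
    "('n \<Rightarrow> 'n \<Rightarrow> real) \<Rightarrow> ('n \<Rightarrow> 'n \<Rightarrow> real^'n \<Rightarrow> real) \<Rightarrow> ('n \<Rightarrow> 'n \<Rightarrow> real \<Rightarrow> real) \<Rightarrow>
     (real^'n \<Rightarrow> real) \<Rightarrow> (real^'n \<Rightarrow> real) \<Rightarrow> real \<Rightarrow> real^'n \<Rightarrow> real \<Rightarrow> real" where
  "value_function \<omega> \<Theta> L F G T p0 t =
     (SUP (p, v)\<in>admissible \<omega> \<Theta> t T p0. objective \<omega> \<Theta> L F G t T p v)"

definition optimal ::
    "('n \<Rightarrow> 'n \<Rightarrow> real) \<Rightarrow> ('n \<Rightarrow> 'n \<Rightarrow> real^'n \<Rightarrow> real) \<Rightarrow> ('n \<Rightarrow> 'n \<Rightarrow> real \<Rightarrow> real) \<Rightarrow>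
     (real^'n \<Rightarrow> real) \<Rightarrow> (real^'n \<Rightarrow> real) \<Rightarrow> real \<Rightarrow> real \<Rightarrow> real^'n \<Rightarrow>
     (real \<Rightarrow> real^'n) \<Rightarrow> (real \<Rightarrow> 'n \<Rightarrow> 'n \<Rightarrow> real) \<Rightarrow> bool" where
  "optimal \<omega> \<Theta> L F G t T p0 p v \<longleftrightarrow>
     (p, v) \<in> admissible \<omega> \<Theta> t T p0 \<and>
     objective \<omega> \<Theta> L F G t T p v = value_function \<omega> \<Theta> L F G T p0 t"


section \<open>Stationarity of the Lagrange functional\<close>

definition lagrange_functional ::
    "('n \<Rightarrow> 'n \<Rightarrow> real) \<Rightarrow> ('n \<Rightarrow> 'n \<Rightarrow> real^'n \<Rightarrow> real) \<Rightarrow> ('n \<Rightarrow> 'n \<Rightarrow> real \<Rightarrow> real) \<Rightarrow>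
     (real^'n \<Rightarrow> real) \<Rightarrow> (real^'n \<Rightarrow> real) \<Rightarrow> real \<Rightarrow> real \<Rightarrow>
     (real \<Rightarrow> real^'n) \<Rightarrow> (real \<Rightarrow> 'n \<Rightarrow> 'n \<Rightarrow> real) \<Rightarrow> (real \<Rightarrow> real^'n) \<Rightarrow> real" where
  "lagrange_functional \<omega> \<Theta> L F G t T p v \<Phi> =
     objective \<omega> \<Theta> L F G t T p v -
     integral {t..T} (\<lambda>s. \<Sum>i\<in>UNIV. \<Phi> s $ i * continuity_residual \<omega> \<Theta> t T p v s i)"

text \<open>The edge Lagrangians need not be differentiable (\<open>L a = \<bar>a\<bar> + a\<^sup>2\<close> is allowed), so in the
  velocity, where the functional is concave and to be maximised, stationarity means that no
  one-sided directional derivative is positive. As the directions form a vector space, this says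
  that the derivative vanishes whenever the functional is Gateaux differentiable.\<close>

definition stationary_velocity ::
    "('n \<Rightarrow> 'n \<Rightarrow> real) \<Rightarrow> ('n \<Rightarrow> 'n \<Rightarrow> real^'n \<Rightarrow> real) \<Rightarrow> ('n \<Rightarrow> 'n \<Rightarrow> real \<Rightarrow> real) \<Rightarrow>
     (real^'n \<Rightarrow> real) \<Rightarrow> (real^'n \<Rightarrow> real) \<Rightarrow> real \<Rightarrow> real \<Rightarrow>
     (real \<Rightarrow> real^'n) \<Rightarrow> (real \<Rightarrow> 'n \<Rightarrow> 'n \<Rightarrow> real) \<Rightarrow> (real \<Rightarrow> real^'n) \<Rightarrow> bool" where
  "stationary_velocity \<omega> \<Theta> L F G t T p v \<Phi> \<longleftrightarrow>
     (\<forall>w. velocity_field \<omega> t T w \<longrightarrow>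
        (\<exists>D\<le>0. ((\<lambda>\<epsilon>. lagrange_functional \<omega> \<Theta> L F G t T p (\<lambda>s i j. v s i j + \<epsilon> * w s i j) \<Phi>)
                  has_real_derivative D) (at_right 0)))"

text \<open>Stationarity in \<open>p\<^sub>s\<close> and in the end point \<open>p\<^sub>T\<close>: the initial value is prescribed, the end
  value is free. The directions range over the whole ambient space; conservation of total mass is
  not imposed separately, being a consequence of the continuity equation.\<close>

definition stationary_density ::
    "('n \<Rightarrow> 'n \<Rightarrow> real) \<Rightarrow> ('n \<Rightarrow> 'n \<Rightarrow> real^'n \<Rightarrow> real) \<Rightarrow> ('n \<Rightarrow> 'n \<Rightarrow> real \<Rightarrow> real) \<Rightarrow>
     (real^'n \<Rightarrow> real) \<Rightarrow> (real^'n \<Rightarrow> real) \<Rightarrow> real \<Rightarrow> real \<Rightarrow>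
     (real \<Rightarrow> real^'n) \<Rightarrow> (real \<Rightarrow> 'n \<Rightarrow> 'n \<Rightarrow> real) \<Rightarrow> (real \<Rightarrow> real^'n) \<Rightarrow> bool" where
  "stationary_density \<omega> \<Theta> L F G t T p v \<Phi> \<longleftrightarrow>
     (\<forall>q. C1_curve t T q \<and> q t = 0 \<longrightarrow>
        ((\<lambda>\<epsilon>. lagrange_functional \<omega> \<Theta> L F G t T (\<lambda>s. p s + \<epsilon> *\<^sub>R q s) v \<Phi>)
           has_real_derivative 0) (at 0))"

definition stationary_multiplier ::
    "('n \<Rightarrow> 'n \<Rightarrow> real) \<Rightarrow> ('n \<Rightarrow> 'n \<Rightarrow> real^'n \<Rightarrow> real) \<Rightarrow> ('n \<Rightarrow> 'n \<Rightarrow> real \<Rightarrow> real) \<Rightarrow>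
     (real^'n \<Rightarrow> real) \<Rightarrow> (real^'n \<Rightarrow> real) \<Rightarrow> real \<Rightarrow> real \<Rightarrow>
     (real \<Rightarrow> real^'n) \<Rightarrow> (real \<Rightarrow> 'n \<Rightarrow> 'n \<Rightarrow> real) \<Rightarrow> (real \<Rightarrow> real^'n) \<Rightarrow> bool" where
  "stationary_multiplier \<omega> \<Theta> L F G t T p v \<Phi> \<longleftrightarrow>
     (\<forall>\<Psi>. continuous_on {t..T} \<Psi> \<longrightarrow>
        ((\<lambda>\<epsilon>. lagrange_functional \<omega> \<Theta> L F G t T p v (\<lambda>s. \<Phi> s + \<epsilon> *\<^sub>R \<Psi> s))
           has_real_derivative 0) (at 0))"

definition lagrange_multiplier ::
    "('n \<Rightarrow> 'n \<Rightarrow> real) \<Rightarrow> ('n \<Rightarrow> 'n \<Rightarrow> real^'n \<Rightarrow> real) \<Rightarrow> ('n \<Rightarrow> 'n \<Rightarrow> real \<Rightarrow> real) \<Rightarrow>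
     (real^'n \<Rightarrow> real) \<Rightarrow> (real^'n \<Rightarrow> real) \<Rightarrow> real \<Rightarrow> real \<Rightarrow>
     (real \<Rightarrow> real^'n) \<Rightarrow> (real \<Rightarrow> 'n \<Rightarrow> 'n \<Rightarrow> real) \<Rightarrow> (real \<Rightarrow> real^'n) \<Rightarrow> bool" where
  "lagrange_multiplier \<omega> \<Theta> L F G t T p v \<Phi> \<longleftrightarrow>
     stationary_velocity \<omega> \<Theta> L F G t T p v \<Phi> \<and> stationary_density \<omega> \<Theta> L F G t T p v \<Phi>"

definition euler_lagrange ::
    "('n \<Rightarrow> 'n \<Rightarrow> real) \<Rightarrow> ('n \<Rightarrow> 'n \<Rightarrow> real^'n \<Rightarrow> real) \<Rightarrow> ('n \<Rightarrow> 'n \<Rightarrow> real \<Rightarrow> real) \<Rightarrow>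
     (real^'n \<Rightarrow> real) \<Rightarrow> (real^'n \<Rightarrow> real) \<Rightarrow> real \<Rightarrow> real \<Rightarrow> real^'n \<Rightarrow>
     (real \<Rightarrow> real^'n) \<Rightarrow> (real \<Rightarrow> 'n \<Rightarrow> 'n \<Rightarrow> real) \<Rightarrow> (real \<Rightarrow> real^'n) \<Rightarrow> bool" where
  "euler_lagrange \<omega> \<Theta> L F G t T p0 p v \<Phi> \<longleftrightarrow>
     p t = p0 \<and>
     stationary_velocity \<omega> \<Theta> L F G t T p v \<Phi> \<and>
     stationary_density \<omega> \<Theta> L F G t T p v \<Phi> \<and>
     stationary_multiplier \<omega> \<Theta> L F G t T p v \<Phi>"


section \<open>The Hamiltonian system\<close>

definition hamiltonian_system ::
    "('n \<Rightarrow> 'n \<Rightarrow> real) \<Rightarrow> ('n \<Rightarrow> 'n \<Rightarrow> real^'n \<Rightarrow> real) \<Rightarrow> ('n \<Rightarrow> 'n \<Rightarrow> real \<Rightarrow> real) \<Rightarrow>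
     (real^'n \<Rightarrow> real) \<Rightarrow> (real^'n \<Rightarrow> real) \<Rightarrow> real \<Rightarrow> real \<Rightarrow> real^'n \<Rightarrow>
     (real \<Rightarrow> real^'n) \<Rightarrow> (real \<Rightarrow> real^'n) \<Rightarrow> bool" where
  "hamiltonian_system \<omega> \<Theta> H F G t T p0 p \<Phi> \<longleftrightarrow>
     (\<forall>s\<in>{t..T}. \<forall>i.
        ((\<lambda>r. p r $ i) has_real_derivative
           - (\<Sum>j\<in>nbrs \<omega> i. sqrt (\<omega> i j) * \<Theta> i j (p s) * deriv (H i j) (graph_grad \<omega> (\<Phi> s) i j)))
          (at s within {t..T})) \<and>
     (\<forall>s\<in>{t..T}. \<forall>i.
        ((\<lambda>r. \<Phi> r $ i) has_real_derivative
           - ((\<Sum>j\<in>nbrs \<omega> i. H i j (graph_grad \<omega> (\<Phi> s) i j) * partial_deriv i (\<Theta> i j) (p s)) +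
              partial_deriv i F (p s)))
          (at s within {t..T})) \<and>
     p t = p0 \<and> (\<forall>i. \<Phi> T $ i = partial_deriv i G (p T))"

definition feedback_control ::
    "('n \<Rightarrow> 'n \<Rightarrow> real) \<Rightarrow> ('n \<Rightarrow> 'n \<Rightarrow> real \<Rightarrow> real) \<Rightarrow> real \<Rightarrow> real \<Rightarrow>
     (real \<Rightarrow> 'n \<Rightarrow> 'n \<Rightarrow> real) \<Rightarrow> (real \<Rightarrow> real^'n) \<Rightarrow> bool" where
  "feedback_control \<omega> H t T v \<Phi> \<longleftrightarrow>
     (\<forall>s\<in>{t..T}. \<forall>(i, j)\<in>edges \<omega>. v s i j = deriv (H i j) (graph_grad \<omega> (\<Phi> s) i j))"

end

theory Submission
  imports Defs
begin

text \<open>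
  The three stationarity conditions can be read off separately once the Lagrange functional is
  written in Legendre form. Write \<open>g\<^sub>i\<^sub>j = sqrt \<omega>\<^sub>i\<^sub>j (\<Phi>\<^sub>j - \<Phi>\<^sub>i)\<close>. Since the fluxes \<open>v\<^sub>i\<^sub>j \<Theta>\<^sub>i\<^sub>j\<close> are
  antisymmetric, pairing \<open>\<Phi>\<close> with their divergence is, up to the factor \<open>-1/2\<close>, the sum of
  \<open>g\<^sub>i\<^sub>j v\<^sub>i\<^sub>j \<Theta>\<^sub>i\<^sub>j\<close> over the edges. The functional is therefore

  \<open>G (p\<^sub>T) + \<integral> (F (p) + 1/2 \<Sum>\<^sub>E \<Theta>\<^sub>i\<^sub>j (p) (g\<^sub>i\<^sub>j v\<^sub>i\<^sub>j - L\<^sub>i\<^sub>j (v\<^sub>i\<^sub>j))) - \<integral> \<Phi> \<bullet> p'\<close>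

  (\<open>lagrange_functional_legendre_form\<close>), and each edge contributes exactly the expression whose
  maximum over the velocity is \<open>H\<^sub>i\<^sub>j (g\<^sub>i\<^sub>j)\<close>.

  In the velocity the functional is concave, so the absence of an increasing direction means global
  maximality (\<open>concave_right_derivative_nonpos_iff\<close>). As \<open>\<Theta>\<^sub>i\<^sub>j (p) > 0\<close>, an integral of continuous
  functions is maximised exactly when Young's inequality is an equality on every edge at every
  time, and strict convexity makes \<open>v\<^sub>i\<^sub>j = H\<^sub>i\<^sub>j' (g\<^sub>i\<^sub>j)\<close> the only velocity with that property
  (\<open>stationary_velocity_iff_feedback\<close>). This needs \<open>H\<^sub>i\<^sub>j\<close> to be \<open>C\<^sup>1\<close> although \<open>L\<^sub>i\<^sub>j\<close> may have
  kinks: strict convexity makes the maximiser of \<open>a b - L\<^sub>i\<^sub>j (a)\<close> unique and continuous in \<open>b\<close>, and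
  the subgradient inequality turns it into the derivative of \<open>H\<^sub>i\<^sub>j\<close>.

  In the density the functional is differentiated under the integral sign. Its first variation is
  \<open>\<nabla>G (p\<^sub>T) \<bullet> q\<^sub>T + \<integral> A \<bullet> q - \<integral> \<Phi> \<bullet> q'\<close>, where \<open>A\<close> is the spatial gradient of the integrand above, and
  a du Bois-Reymond argument with free end point (\<open>du_bois_reymond_free_end\<close>) shows that it vanishes
  for all \<open>q\<close> with \<open>q\<^sub>t = 0\<close> exactly when \<open>\<Phi>\<close> is differentiable with \<open>\<Phi>' = - A\<close> and
  \<open>\<Phi>\<^sub>T = \<nabla>G (p\<^sub>T)\<close>. In this step the multiplier, assumed only continuous, gains its regularity. In
  the multiplier the functional is affine, so stationarity is the continuity equation. Substituting
  the feedback velocity into the last two conditions gives the Hamiltonian system.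
\<close>

section \<open>Convex conjugates of strictly convex superlinear functions\<close>

lemma strictly_convex_imp_convex_on:
  assumes "strictly_convex f"
  shows "convex_on UNIV f"
proof (rule convex_onI)
  fix u x y :: real
  assume u: "0 < u" "u < 1"
  show "f ((1 - u) *\<^sub>R x + u *\<^sub>R y) \<le> (1 - u) * f x + u * f y"
  proof (cases "x = y")
    case True
    then show ?thesis by (simp add: algebra_simps)
  next
    case False
    then show ?thesis
      using assms u unfolding strictly_convex_def
      by (smt (verit, best) real_scaleR_def)
  qed
qed simp

lemma strictly_convex_continuous:
  "strictly_convex f \<Longrightarrow> continuous_on UNIV f"
  by (simp add: convex_on_continuous strictly_convex_imp_convex_on)

text \<open>Superlinearity, with a slope exceeding \<open>\<bar>b\<bar>\<close>, confines the search to a compact interval, where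
  continuity yields a maximiser; two maximisers would contradict strict convexity at their midpoint.\<close>

lemma legendre_maximiser_exists:
  assumes f: "strictly_convex f" "superlinear f"
  shows "\<exists>a. \<forall>x. x \<noteq> a \<longrightarrow> x * b - f x < a * b - f a"
proof -
  have "\<forall>\<^sub>F x in at_infinity. \<bar>b\<bar> + 1 + \<bar>f 0\<bar> \<le> f x / \<bar>x\<bar>"
    using f(2) by (simp add: superlinear_def filterlim_at_top)
  then obtain R where R: "\<And>x. R \<le> norm x \<Longrightarrow> \<bar>b\<bar> + 1 + \<bar>f 0\<bar> \<le> f x / \<bar>x\<bar>"
    by (auto simp: eventually_at_infinity)
  define r where "r = max R 1"
  \<comment> \<open>The summand \<open>\<bar>f 0\<bar>\<close> in the slope makes \<open>0\<close> a better choice than any point outside the interval.\<close>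
  have far: "x * b - f x \<le> 0 * b - f 0" if "r \<le> \<bar>x\<bar>" for x
  proof -
    have x: "1 \<le> \<bar>x\<bar>" "R \<le> norm x" using that by (auto simp: r_def)
    then have "(\<bar>b\<bar> + 1 + \<bar>f 0\<bar>) * \<bar>x\<bar> \<le> f x"
      using R[of x] by (simp add: pos_le_divide_eq)
    moreover have "x * b \<le> \<bar>b\<bar> * \<bar>x\<bar>"
      by (metis abs_ge_self abs_mult mult.commute)
    moreover have "\<bar>f 0\<bar> * 1 \<le> \<bar>f 0\<bar> * \<bar>x\<bar>"
      using x by (intro mult_left_mono) auto
    moreover have "f 0 \<le> \<bar>f 0\<bar>" by simp
    ultimately show ?thesis using x unfolding distrib_right by linarith
  qed
  have "continuous_on {- r..r} (\<lambda>x. x * b - f x)"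
    by (intro continuous_intros continuous_on_subset[OF strictly_convex_continuous[OF f(1)]]) auto
  moreover have "{- r..r} \<noteq> {}" by (auto simp: r_def)
  ultimately obtain a where a: "\<And>x. x \<in> {- r..r} \<Longrightarrow> x * b - f x \<le> a * b - f a"
    using continuous_attains_sup[of "{- r..r}" "\<lambda>x. x * b - f x"] compact_Icc by blast
  have le: "x * b - f x \<le> a * b - f a" for x
  proof (cases "r \<le> \<bar>x\<bar>")
    case True
    then show ?thesis using far[OF True] a[of 0] unfolding r_def by fastforce
  next
    case False
    then show ?thesis by (intro a) auto
  qed
  have "x * b - f x < a * b - f a" if "x \<noteq> a" for x
  proof (rule ccontr)
    assume "\<not> ?thesis"
    then have eq: "x * b - f x = a * b - f a" using le[of x] by simp
    have "f (1/2 * x + (1 - 1/2) * a) < 1/2 * f x + (1 - 1/2) * f a"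
      using f(1) that unfolding strictly_convex_def by (smt (verit) field_sum_of_halves)
    then show False using le[of "1/2 * x + (1 - 1/2) * a"] eq by (simp add: algebra_simps)
  qed
  then show ?thesis by blast
qed

definition legendre_maximiser :: "(real \<Rightarrow> real) \<Rightarrow> real \<Rightarrow> real" where
  "legendre_maximiser f b = (SOME a. \<forall>x. x \<noteq> a \<longrightarrow> x * b - f x < a * b - f a)"

context
  fixes f :: "real \<Rightarrow> real"
  assumes f: "strictly_convex f" "superlinear f"
begin

lemma legendre_maximiser_less:
  "x \<noteq> legendre_maximiser f b \<Longrightarrow>
    x * b - f x < legendre_maximiser f b * b - f (legendre_maximiser f b)"
  using someI_ex[OF legendre_maximiser_exists[OF f]] unfolding legendre_maximiser_def by blast

lemma convex_conjugate_eq: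
  "convex_conjugate f b = legendre_maximiser f b * b - f (legendre_maximiser f b)"
  unfolding convex_conjugate_def
  by (rule cSup_eq_maximum) (use legendre_maximiser_less in \<open>auto intro: less_imp_le\<close>, 
      metis legendre_maximiser_less order.order_iff_strict)

text \<open>The line \<open>c \<mapsto> a c - f a\<close> lies below the conjugate for every \<open>a\<close>, and for the maximiser \<open>a\<close> at \<open>b\<close> it
  touches the conjugate at \<open>b\<close>.\<close>

lemma convex_conjugate_subgradient:
  "legendre_maximiser f b * (c - b) \<le> convex_conjugate f c - convex_conjugate f b"
proof -
  have "legendre_maximiser f b * c - f (legendre_maximiser f b) \<le> convex_conjugate f c"
    unfolding convex_conjugate_eq
    using legendre_maximiser_less[of "legendre_maximiser f b" c] by fastforce
  then show ?thesis by (simp add: convex_conjugate_eq algebra_simps)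
qed

text \<open>Around its maximiser \<open>a\<close> the strictly concave function \<open>x \<mapsto> x b - f x\<close> has dropped by some \<open>d > 0\<close> at
  distance \<open>e\<close>, and by concavity it keeps dropping at least with slope \<open>d / e\<close> further out. Tilting it
  by a slope smaller than \<open>d / e\<close>, that is, changing \<open>b\<close> by less than \<open>d / e\<close>, cannot move the maximiser
  out of the interval of radius \<open>e\<close>.\<close>

lemma isCont_legendre_maximiser: "isCont (legendre_maximiser f) b"
  unfolding continuous_at_eps_delta
proof (intro allI impI)
  fix e :: real assume e: "0 < e"
  define a where "a = legendre_maximiser f b"
  define g where "g x = x * b - f x" for x
  define d where "d = min (g a - g (a + e)) (g a - g (a - e))"
  have d: "0 < d"
    using legendre_maximiser_less[of "a + e" b] legendre_maximiser_less[of "a - e" b] e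
    by (simp add: d_def g_def a_def)
  have cvx: "convex_on UNIV (\<lambda>x. - g x)"
    using convex_on_add[OF strictly_convex_imp_convex_on[OF f(1)], of "\<lambda>x. - b * x"]
    by (simp add: g_def convex_on_def algebra_simps)
  have far: "g x \<le> g a - d / e * \<bar>x - a\<bar>" if x: "e \<le> \<bar>x - a\<bar>" for x
  proof -
    \<comment> \<open>The point \<open>y\<close> at distance \<open>e\<close> from \<open>a\<close> on the side of \<open>x\<close> is a convex combination of \<open>a\<close> and \<open>x\<close>.\<close>
    define u where "u = e / \<bar>x - a\<bar>"
    define y where "y = (if a < x then a + e else a - e)"
    have u: "0 < u" "u \<le> 1" using e x by (auto simp: u_def)
    have "y = (1 - u) *\<^sub>R a + u *\<^sub>R x"
      using e x by (auto simp: u_def y_def field_simps)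
    then have "- g y \<le> (1 - u) * (- g a) + u * (- g x)"
      using convex_onD[OF cvx, of u a x] u by simp
    moreover have "d \<le> g a - g y" by (simp add: y_def d_def)
    ultimately have "d \<le> u * (g a - g x)" by (simp add: algebra_simps)
    then show ?thesis using e x by (simp add: u_def field_simps)
  qed
  show "\<exists>h>0. \<forall>c. dist c b < h \<longrightarrow> dist (legendre_maximiser f c) (legendre_maximiser f b) < e"
  proof (intro exI[of _ "d / e"] conjI allI impI)
    fix c assume c: "dist c b < d / e"
    define x where "x = legendre_maximiser f c"
    show "dist x (legendre_maximiser f b) < e"
    proof (rule ccontr)
      assume "\<not> ?thesis"
      then have x: "e \<le> \<bar>x - a\<bar>" by (simp add: dist_real_def a_def)
      have "(x - a) * (c - b) \<le> \<bar>x - a\<bar> * \<bar>c - b\<bar>"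
        by (metis abs_ge_self abs_mult)
      also have "\<dots> < \<bar>x - a\<bar> * (d / e)"
        using c x e by (intro mult_strict_left_mono) (auto simp: dist_real_def)
      finally have "(x - a) * (c - b) < d / e * \<bar>x - a\<bar>" by (simp add: mult.commute)
      with far[OF x] have "x * c - f x < a * c - f a"
        by (simp add: g_def algebra_simps)
      moreover have "a * c - f a \<le> x * c - f x"
        using legendre_maximiser_less[of a c] unfolding x_def by fastforce
      ultimately show False by simp
    qed
  qed (use d e in simp)
qed

text \<open>Applied in both directions, the subgradient inequality traps the difference quotient between the
  maximisers at the two points, which come together by continuity.\<close>

lemma convex_conjugate_has_derivative:
  "(convex_conjugate f has_real_derivative legendre_maximiser f b) (at b)"
  unfolding has_field_derivative_iff
proof (rule Lim_null[THEN iffD2], rule Lim_null_comparison)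
  have m: "(legendre_maximiser f \<longlongrightarrow> legendre_maximiser f b) (at b)"
    using isCont_legendre_maximiser by (simp add: isCont_def)
  then show "((\<lambda>c. \<bar>legendre_maximiser f c - legendre_maximiser f b\<bar>) \<longlongrightarrow> 0) (at b)"
    by (intro tendsto_rabs_zero) (simp flip: Lim_null)
  show "\<forall>\<^sub>F c in at b. norm ((convex_conjugate f c - convex_conjugate f b) / (c - b) 
      - legendre_maximiser f b) \<le> \<bar>legendre_maximiser f c - legendre_maximiser f b\<bar>"
    unfolding eventually_at
  proof (intro exI[of _ 1] conjI ballI impI)
    fix c assume c: "c \<noteq> b \<and> dist c b < 1"
    let ?D = "convex_conjugate f c - convex_conjugate f b"
    let ?b = "legendre_maximiser f b" and ?c = "legendre_maximiser f c"
    have lo: "?b * (c - b) \<le> ?D" and hi: "?D \<le> ?c * (c - b)"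
      using convex_conjugate_subgradient[of b c] convex_conjugate_subgradient[of c b]
      by (auto simp: algebra_simps)
    consider "b < c" | "c < b" using c by linarith
    then have "(?b \<le> ?D / (c - b) \<and> ?D / (c - b) \<le> ?c) \<or> (?c \<le> ?D / (c - b) \<and> ?D / (c - b) \<le> ?b)"
      using lo hi by cases (auto simp: pos_le_divide_eq pos_divide_le_eq neg_le_divide_eq neg_divide_le_eq)
    then show "norm (?D / (c - b) - ?b) \<le> \<bar>?c - ?b\<bar>" by auto
  qed simp
qed

lemma deriv_convex_conjugate: "deriv (convex_conjugate f) = legendre_maximiser f"
  using convex_conjugate_has_derivative by (auto intro!: DERIV_imp_deriv)

lemma convex_conjugate_differentiable: "convex_conjugate f field_differentiable at b"
  using convex_conjugate_has_derivative by (auto simp: field_differentiable_def)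

lemma continuous_on_deriv_convex_conjugate: "continuous_on S (deriv (convex_conjugate f))"
  unfolding deriv_convex_conjugate
  by (simp add: continuous_at_imp_continuous_on isCont_legendre_maximiser)

lemma young_inequality: "a * b - f a \<le> convex_conjugate f b"
  unfolding convex_conjugate_eq using legendre_maximiser_less[of a b] by fastforce

text \<open>Uniqueness of the maximiser is what lets the optimal velocity be recovered from equality in Young's
  inequality.\<close>

lemma young_equality_iff:
  "a * b - f a = convex_conjugate f b \<longleftrightarrow> a = deriv (convex_conjugate f) b"
  unfolding convex_conjugate_eq deriv_convex_conjugate
  using legendre_maximiser_less[of a b] by fastforce

text \<open>If \<open>c\<close> is the maximiser at \<open>- b\<close>, evenness makes \<open>- c\<close> attain equality in Young's inequality at \<open>b\<close>.\<close>

lemma deriv_convex_conjugate_odd: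
  assumes "\<And>a. f (- a) = f a"
  shows "deriv (convex_conjugate f) (- b) = - deriv (convex_conjugate f) b"
proof -
  let ?a = "deriv (convex_conjugate f) b" and ?c = "deriv (convex_conjugate f) (- b)"
  have "?a * b - f ?a = convex_conjugate f b" "?c * (- b) - f ?c = convex_conjugate f (- b)"
    by (simp_all only: young_equality_iff)
  moreover have "- ?c * b - f (- ?c) \<le> convex_conjugate f b"
      "- ?a * (- b) - f (- ?a) \<le> convex_conjugate f (- b)"
    by (rule young_inequality)+
  ultimately have "- ?c * b - f (- ?c) = convex_conjugate f b" by (simp add: assms)
  then show ?thesis unfolding young_equality_iff by simp
qed

end

section \<open>Stationarity of concave functions\<close>

text \<open>The difference quotients of a concave function decrease in the step size. Hence a right
  derivative bounds all of them from above; and if the function is maximal at \<open>0\<close> on the right, the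
  quotients are bounded by \<open>0\<close>, so their supremum is a right derivative, which therefore exists
  even at a kink.\<close>

lemma concave_right_derivative_nonpos_iff:
  fixes J :: "real \<Rightarrow> real"
  assumes J: "concave_on UNIV J"
  shows "(\<exists>D\<le>0. (J has_real_derivative D) (at_right 0)) \<longleftrightarrow> (\<forall>x\<ge>0. J x \<le> J 0)"
proof
  have slope: "(J y - J 0) / y \<le> (J x - J 0) / x" if "0 < x" "x \<le> y" for x y
  proof -
    have "(1 - x / y) * J 0 + x / y * J y \<le> J ((1 - x / y) *\<^sub>R 0 + (x / y) *\<^sub>R y)"
      using that by (intro concave_onD[OF J]) auto
    then show ?thesis using that by (simp add: field_simps)
  qed
  {
    assume "\<exists>D\<le>0. (J has_real_derivative D) (at_right 0)"
    then obtain D where D: "D \<le> 0" "((\<lambda>x. (J x - J 0) / x) \<longlongrightarrow> D) (at_right 0)"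
      by (auto simp: has_field_derivative_iff)
    show "\<forall>x\<ge>0. J x \<le> J 0"
    proof (intro allI impI)
      fix x :: real assume "0 \<le> x"
      show "J x \<le> J 0"
      proof (cases "x = 0")
        case False
        with \<open>0 \<le> x\<close> have x: "0 < x" by simp
        have "(J x - J 0) / x \<le> D"
          by (rule tendsto_lowerbound[OF D(2)])
            (use x slope in \<open>auto intro!: eventually_at_rightI[of 0 x]\<close>)
        with D(1) have "(J x - J 0) / x \<le> 0" by linarith
        then show ?thesis using x by (simp add: divide_le_0_iff)
      qed simp
    qed
  }
  {
    assume max: "\<forall>x\<ge>0. J x \<le> J 0"
    define r where "r x = (J x - J 0) / x" for x
    have r: "r x \<le> 0" if "0 < x" for x
      using max that by (simp add: r_def divide_le_0_iff)
    define D where "D = Sup (r ` {0<..})"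
    have bdd: "bdd_above (r ` {0<..})" using r by (auto intro!: bdd_aboveI[of _ 0])
    have up: "r x \<le> D" if "0 < x" for x
      unfolding D_def by (rule cSup_upper[OF _ bdd]) (use that in auto)
    have "D \<le> 0" unfolding D_def by (rule cSup_least) (use r in auto)
    moreover have "(r \<longlongrightarrow> D) (at_right 0)"
    proof (rule order_tendstoI)
      fix l assume "l < D"
      then obtain x where x: "0 < x" "l < r x"
        unfolding D_def using less_cSup_iff[OF _ bdd] by auto
      show "\<forall>\<^sub>F y in at_right 0. l < r y"
        by (rule eventually_at_rightI[of 0 x])
          (use x slope[of _ x] in \<open>fastforce simp: r_def\<close>)+
    next
      fix u assume "D < u"
      then show "\<forall>\<^sub>F y in at_right 0. r y < u"
        using up by (intro eventually_at_rightI[of 0 1]) fastforce+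
    qed
    ultimately show "\<exists>D\<le>0. (J has_real_derivative D) (at_right 0)"
      by (auto simp: has_field_derivative_iff r_def[abs_def])
  }
qed

section \<open>The fundamental lemma of the calculus of variations with free end point\<close>

lemma integration_by_parts_from_zero:
  fixes \<Phi> q :: "real \<Rightarrow> 'a::euclidean_space"
  assumes tT: "t \<le> T"
    and \<Phi>: "\<And>s. s \<in> {t..T} \<Longrightarrow> (\<Phi> has_vector_derivative \<Phi>' s) (at s within {t..T})"
    and q: "\<And>s. s \<in> {t..T} \<Longrightarrow> (q has_vector_derivative q' s) (at s within {t..T})"
    and \<Phi>': "continuous_on {t..T} \<Phi>'" and q': "continuous_on {t..T} q'" and "q t = 0"
  shows "integral {t..T} (\<lambda>s. \<Phi> s \<bullet> q' s) = \<Phi> T \<bullet> q T - integral {t..T} (\<lambda>s. \<Phi>' s \<bullet> q s)"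
proof -
  have [continuous_intros]: "continuous_on {t..T} \<Phi>" "continuous_on {t..T} q"
    by (rule continuous_on_vector_derivative, erule \<Phi>)
      (rule continuous_on_vector_derivative, erule q)
  have "((\<lambda>s. \<Phi> s \<bullet> q' s + \<Phi>' s \<bullet> q s) has_integral \<Phi> T \<bullet> q T - \<Phi> t \<bullet> q t) {t..T}"
    by (rule fundamental_theorem_of_calculus[OF tT],
        rule bounded_bilinear.has_vector_derivative[OF bounded_bilinear_inner \<Phi> q])
  then have "integral {t..T} (\<lambda>s. \<Phi> s \<bullet> q' s + \<Phi>' s \<bullet> q s) = \<Phi> T \<bullet> q T"
    using \<open>q t = 0\<close> by (simp add: integral_unique)
  also have "integral {t..T} (\<lambda>s. \<Phi> s \<bullet> q' s + \<Phi>' s \<bullet> q s) =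
      integral {t..T} (\<lambda>s. \<Phi> s \<bullet> q' s) + integral {t..T} (\<lambda>s. \<Phi>' s \<bullet> q s)"
    by (intro integral_add integrable_continuous_interval continuous_intros \<Phi>' q')
  finally show ?thesis by simp
qed

text \<open>Let \<open>B\<close> solve \<open>B' = - A\<close> with \<open>B T = g\<close>. Integration by parts turns the weak condition into the
  statement that the integral of \<open>(B - \<Phi>) \<bullet> q'\<close> vanishes. As the end value of \<open>q\<close> is free, the
  primitive of \<open>B - \<Phi>\<close> that vanishes at \<open>t\<close> is an allowed test function, and it gives \<open>\<Phi> = B\<close>.\<close>

lemma du_bois_reymond_free_end:
  fixes \<Phi> A :: "real \<Rightarrow> 'a::euclidean_space"
  assumes tT: "t < T" and \<Phi>: "continuous_on {t..T} \<Phi>" and A: "continuous_on {t..T} A"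
  shows "(\<forall>q q'. (\<forall>s\<in>{t..T}. (q has_vector_derivative q' s) (at s within {t..T})) \<longrightarrow>
            continuous_on {t..T} q' \<longrightarrow> q t = 0 \<longrightarrow>
            g \<bullet> q T + integral {t..T} (\<lambda>s. A s \<bullet> q s) - integral {t..T} (\<lambda>s. \<Phi> s \<bullet> q' s) = 0)
     \<longleftrightarrow> (\<forall>s\<in>{t..T}. (\<Phi> has_vector_derivative - A s) (at s within {t..T})) \<and> \<Phi> T = g"
    (is "?weak \<longleftrightarrow> ?strong")
proof
  assume strong: ?strong
  show ?weak
  proof (intro allI impI)
    fix q q' :: "real \<Rightarrow> 'a"
    assume q: "\<forall>s\<in>{t..T}. (q has_vector_derivative q' s) (at s within {t..T})"
      and q': "continuous_on {t..T} q'" and q0: "q t = 0"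
    have "integral {t..T} (\<lambda>s. \<Phi> s \<bullet> q' s) =
        \<Phi> T \<bullet> q T - integral {t..T} (\<lambda>s. - A s \<bullet> q s)"
      by (rule integration_by_parts_from_zero)
        (use strong tT q q' q0 A in \<open>auto intro: continuous_on_minus\<close>)
    then show "g \<bullet> q T + integral {t..T} (\<lambda>s. A s \<bullet> q s) -
        integral {t..T} (\<lambda>s. \<Phi> s \<bullet> q' s) = 0"
      using strong by simp
  qed
next
  assume weak: ?weak
  define B where "B s = g + integral {s..T} A" for s
  have B: "(B has_vector_derivative - A s) (at s within {t..T})" if "s \<in> {t..T}" for s
    unfolding B_def using integral_has_vector_derivative'[OF A that]
    by (auto intro!: derivative_eq_intros)
  have B_cont: "continuous_on {t..T} B"
    using B by (rule continuous_on_vector_derivative)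
  define q where "q s = integral {t..s} (\<lambda>r. B r - \<Phi> r)" for s
  have q: "(q has_vector_derivative B s - \<Phi> s) (at s within {t..T})" if "s \<in> {t..T}" for s
    unfolding q_def
    by (rule integral_has_vector_derivative[OF continuous_on_diff[OF B_cont \<Phi>] that])
  have q': "continuous_on {t..T} (\<lambda>s. B s - \<Phi> s)"
    by (intro continuous_intros B_cont \<Phi>)
  have q0: "q t = 0" by (simp add: q_def)
  have "g \<bullet> q T + integral {t..T} (\<lambda>s. A s \<bullet> q s) = integral {t..T} (\<lambda>s. \<Phi> s \<bullet> (B s - \<Phi> s))"
    using weak[rule_format, of q "\<lambda>s. B s - \<Phi> s", OF q q' q0] by simp
  moreover have "integral {t..T} (\<lambda>s. B s \<bullet> (B s - \<Phi> s)) =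
      g \<bullet> q T + integral {t..T} (\<lambda>s. A s \<bullet> q s)"
  proof -
    have "integral {t..T} (\<lambda>s. B s \<bullet> (B s - \<Phi> s)) =
        B T \<bullet> q T - integral {t..T} (\<lambda>s. - A s \<bullet> q s)"
      by (rule integration_by_parts_from_zero[OF _ B q])
        (use tT q' q0 A in \<open>auto intro: continuous_on_minus\<close>)
    then show ?thesis by (simp add: B_def)
  qed
  moreover have "integral {t..T} (\<lambda>s. (B s - \<Phi> s) \<bullet> (B s - \<Phi> s)) =
      integral {t..T} (\<lambda>s. B s \<bullet> (B s - \<Phi> s)) - integral {t..T} (\<lambda>s. \<Phi> s \<bullet> (B s - \<Phi> s))"
    unfolding inner_diff_left
    by (intro integral_diff integrable_continuous_interval continuous_intros B_cont \<Phi>)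
  ultimately have "integral {t..T} (\<lambda>s. (B s - \<Phi> s) \<bullet> (B s - \<Phi> s)) = 0" by simp
  then have "\<forall>s\<in>{t..T}. (B s - \<Phi> s) \<bullet> (B s - \<Phi> s) = 0"
    by (subst (asm) integral_eq_0_iff) (auto intro!: continuous_intros B_cont \<Phi> tT)
  then have eq: "\<Phi> s = B s" if "s \<in> {t..T}" for s using that by simp
  have "(\<Phi> has_vector_derivative - A s) (at s within {t..T})" if "s \<in> {t..T}" for s
    using has_vector_derivative_transform[OF that eq B[OF that]] by simp
  moreover have "\<Phi> T = g" using eq[of T] tT by (simp add: B_def)
  ultimately show ?strong by blast
qed

section \<open>Gradients and differentiation along a family of curves\<close>

definition gradient :: "(real^'n \<Rightarrow> real) \<Rightarrow> real^'n \<Rightarrow> real^'n" where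
  "gradient f x = (\<chi> k. partial_deriv k f x)"

lemma partial_deriv_eq_derivative:
  assumes "(f has_derivative f') (at x)"
  shows "partial_deriv k f x = f' (axis k 1)"
proof -
  have "((\<lambda>h. f (x + h *\<^sub>R axis k 1)) has_derivative (\<lambda>h. f' (h *\<^sub>R axis k 1))) (at 0)"
  proof (rule has_derivative_compose[of "\<lambda>h. x + h *\<^sub>R axis k 1" "\<lambda>h. h *\<^sub>R axis k 1"])
    show "((\<lambda>h. x + h *\<^sub>R axis k 1) has_derivative (\<lambda>h. h *\<^sub>R axis k 1)) (at 0)"
      by (auto intro!: derivative_eq_intros)
  qed (use assms in simp)
  moreover have "f' (h *\<^sub>R axis k 1) = f' (axis k 1) * h" for h
    using linear_cmul[OF has_derivative_linear[OF assms]] by simp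
  ultimately have "((\<lambda>h. f (x + h *\<^sub>R axis k 1)) has_real_derivative f' (axis k 1)) (at 0)"
    by (simp add: has_field_derivative_def)
  then show ?thesis unfolding partial_deriv_def by (rule DERIV_imp_deriv)
qed

lemma C1_on_has_gradient:
  assumes "C1_on U f" "x \<in> U"
  shows "(f has_derivative (\<lambda>h. gradient f x \<bullet> h)) (at x)"
proof -
  obtain f' where f': "(f has_derivative blinfun_apply f') (at x)"
    using assms unfolding C1_on_def by blast
  have "blinfun_apply f' h = gradient f x \<bullet> h" for h
  proof -
    have "blinfun_apply f' h = blinfun_apply f' (\<Sum>k\<in>UNIV. h $ k *\<^sub>R axis k 1)"
      using basis_expansion[of h] by (simp add: scalar_mult_eq_scaleR)
    also have "\<dots> = (\<Sum>k\<in>UNIV. h $ k * blinfun_apply f' (axis k 1))"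
      by (simp add: blinfun.sum_right blinfun.scaleR_right)
    finally show ?thesis
      by (simp add: inner_vec_def gradient_def partial_deriv_eq_derivative[OF f'] mult.commute)
  qed
  then have "blinfun_apply f' = (\<lambda>h. gradient f x \<bullet> h)" by blast
  with f' show ?thesis by simp
qed

lemma C1_on_continuous_gradient:
  fixes f :: "real^'n \<Rightarrow> real"
  assumes "C1_on U f"
  shows "continuous_on U (gradient f)"
proof -
  obtain f' :: "real^'n \<Rightarrow> (real^'n) \<Rightarrow>\<^sub>L real"
    where f': "\<And>x. x \<in> U \<Longrightarrow> (f has_derivative blinfun_apply (f' x)) (at x)"
      and c: "continuous_on U f'"
    using assms unfolding C1_on_def by blast
  have "continuous_on U (\<lambda>x. \<chi> k. blinfun_apply (f' x) (axis k 1))"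
    by (intro continuous_intros c)
  then show ?thesis
    by (rule continuous_on_eq) (simp add: gradient_def partial_deriv_eq_derivative[OF f'])
qed

lemma C1_on_continuous: "C1_on U f \<Longrightarrow> continuous_on U f"
  unfolding C1_on_def
  by (auto intro!: continuous_at_imp_continuous_on intro: has_derivative_continuous)

lemma C1_on_subset: "C1_on U f \<Longrightarrow> open V \<Longrightarrow> V \<subseteq> U \<Longrightarrow> C1_on V f"
  unfolding C1_on_def by (auto intro: continuous_on_subset)

lemma C1_on_compose_linear:
  assumes f: "C1_on U f" and l: "bounded_linear l" and V: "open V" "l ` V \<subseteq> U"
  shows "C1_on V (\<lambda>x. f (l x))"
proof -
  obtain f' where f': "\<And>x. x \<in> U \<Longrightarrow> (f has_derivative blinfun_apply (f' x)) (at x)"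
      and c: "continuous_on U f'"
    using f unfolding C1_on_def by blast
  have "((\<lambda>x. f (l x)) has_derivative blinfun_apply (f' (l x) o\<^sub>L Blinfun l)) (at x)"
    if "x \<in> V" for x
  proof -
    have "((\<lambda>x. f (l x)) has_derivative (\<lambda>h. blinfun_apply (f' (l x)) (l h))) (at x)"
      by (rule has_derivative_compose[OF bounded_linear_imp_has_derivative[OF l] f'])
        (use that V in auto)
    then show ?thesis
      by (rule has_derivative_eq_rhs) (simp add: fun_eq_iff bounded_linear_Blinfun_apply l)
  qed
  moreover have "continuous_on V (\<lambda>x. f' (l x) o\<^sub>L Blinfun l)"
    using continuous_on_compose2[OF c linear_continuous_on[OF l] V(2)]
    by (intro continuous_intros)
  ultimately show ?thesis
    unfolding C1_on_def
    by (intro conjI exI[of _ "\<lambda>x. f' (l x) o\<^sub>L Blinfun l"] ballI V(1)) simp_all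
qed

text \<open>The curve is a compact subset of \<open>U\<close> and so keeps a positive distance from the complement, while \<open>q\<close>
  is bounded.\<close>

lemma perturbed_curve_stays_in_open:
  fixes p q :: "real \<Rightarrow> 'a::euclidean_space"
  assumes U: "open U" and p: "continuous_on {t..T} p" "\<And>s. s \<in> {t..T} \<Longrightarrow> p s \<in> U"
    and q: "continuous_on {t..T} q"
  obtains \<delta> where "0 < \<delta>" "\<And>\<epsilon> s. \<bar>\<epsilon>\<bar> < \<delta> \<Longrightarrow> s \<in> {t..T} \<Longrightarrow> p s + \<epsilon> *\<^sub>R q s \<in> U"
proof -
  have "compact (p ` {t..T})" "p ` {t..T} \<subseteq> U"
    using p by (auto intro: compact_continuous_image)
  from compact_subset_open_imp_ball_epsilon_subset[OF this(1) U this(2)]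
  obtain r where r: "0 < r" "\<Union> ((\<lambda>x. ball x r) ` p ` {t..T}) \<subseteq> U" by metis
  have "bounded (q ` {t..T})"
    by (simp add: compact_continuous_image compact_imp_bounded q)
  then obtain M where M: "0 < M" "\<And>s. s \<in> {t..T} \<Longrightarrow> norm (q s) \<le> M"
    by (auto simp: bounded_pos)
  show ?thesis
  proof (rule that[of "r / M"])
    fix \<epsilon> s assume "\<bar>\<epsilon>\<bar> < r / M" and s: "s \<in> {t..T}"
    then have "\<bar>\<epsilon>\<bar> * M < r" using M(1) by (simp add: pos_less_divide_eq)
    moreover have "\<bar>\<epsilon>\<bar> * norm (q s) \<le> \<bar>\<epsilon>\<bar> * M" using M(2)[OF s] by (intro mult_left_mono) auto
    ultimately have "p s + \<epsilon> *\<^sub>R q s \<in> ball (p s) r" by (simp add: dist_norm)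
    then show "p s + \<epsilon> *\<^sub>R q s \<in> U" using r(2) s by blast
  qed (use r M in simp)
qed

text \<open>The integrand need only be differentiable on \<open>U\<close>, so the Leibniz rule is applied on the interval of
  those \<open>\<epsilon>\<close> for which the perturbed curve stays in \<open>U\<close>.\<close>

lemma action_has_derivative_along:
  fixes N :: "real \<Rightarrow> 'a::euclidean_space \<Rightarrow> real" and p q :: "real \<Rightarrow> 'a"
  assumes U: "open U" and p: "continuous_on {t..T} p" "\<And>s. s \<in> {t..T} \<Longrightarrow> p s \<in> U"
    and q: "continuous_on {t..T} q"
    and N: "continuous_on ({t..T} \<times> U) (\<lambda>(s, x). N s x)"
    and N': "continuous_on ({t..T} \<times> U) (\<lambda>(s, x). N' s x)"
    and deriv: "\<And>s x. s \<in> {t..T} \<Longrightarrow> x \<in> U \<Longrightarrow> (N s has_derivative (\<lambda>h. N' s x \<bullet> h)) (at x)"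
  shows "((\<lambda>\<epsilon>. integral {t..T} (\<lambda>s. N s (p s + \<epsilon> *\<^sub>R q s))) has_real_derivative
            integral {t..T} (\<lambda>s. N' s (p s) \<bullet> q s)) (at 0)"
proof -
  obtain \<delta> where \<delta>: "0 < \<delta>" "\<And>\<epsilon> s. \<bar>\<epsilon>\<bar> < \<delta> \<Longrightarrow> s \<in> {t..T} \<Longrightarrow> p s + \<epsilon> *\<^sub>R q s \<in> U"
    using perturbed_curve_stays_in_open[OF U p q] by blast
  let ?I = "{- \<delta><..<\<delta>}"
  have in_U: "p s + \<epsilon> *\<^sub>R q s \<in> U" if "\<epsilon> \<in> ?I" "s \<in> {t..T}" for \<epsilon> s
    using that by (intro \<delta>) auto
  have "((\<lambda>\<epsilon>. integral (cbox t T) (\<lambda>s. N s (p s + \<epsilon> *\<^sub>R q s))) has_real_derivative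
            integral (cbox t T) (\<lambda>s. N' s (p s + 0 *\<^sub>R q s) \<bullet> q s)) (at 0 within ?I)"
  proof (rule leibniz_rule_field_derivative)
    fix \<epsilon> s assume e: "\<epsilon> \<in> ?I" and s: "s \<in> cbox t T"
    have "((\<lambda>\<epsilon>. N s (p s + \<epsilon> *\<^sub>R q s)) has_derivative
        (\<lambda>h. N' s (p s + \<epsilon> *\<^sub>R q s) \<bullet> (h *\<^sub>R q s))) (at \<epsilon> within ?I)"
    proof (rule has_derivative_compose[of _ "\<lambda>h. h *\<^sub>R q s"])
      show "((\<lambda>\<epsilon>. p s + \<epsilon> *\<^sub>R q s) has_derivative (\<lambda>h. h *\<^sub>R q s)) (at \<epsilon> within ?I)"
        by (auto intro!: derivative_eq_intros)
    qed (use in_U[OF e] s in \<open>auto intro!: deriv\<close>)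
    then show "((\<lambda>\<epsilon>. N s (p s + \<epsilon> *\<^sub>R q s)) has_real_derivative
        N' s (p s + \<epsilon> *\<^sub>R q s) \<bullet> q s) (at \<epsilon> within ?I)"
      by (simp add: has_field_derivative_def mult_commute_abs)
  next
    fix \<epsilon> assume e: "\<epsilon> \<in> ?I"
    have "continuous_on {t..T} (\<lambda>s. case (s, p s + \<epsilon> *\<^sub>R q s) of (s, x) \<Rightarrow> N s x)"
      by (rule continuous_on_compose2[OF N]) (use in_U e in \<open>auto intro!: continuous_intros p q\<close>)
    then show "(\<lambda>s. N s (p s + \<epsilon> *\<^sub>R q s)) integrable_on cbox t T"
      by (auto intro: integrable_continuous_interval)
  next
    have c: "continuous_on (?I \<times> {t..T}) (\<lambda>z. h (snd z))" if "continuous_on {t..T} h"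
      for h :: "real \<Rightarrow> 'a"
      by (rule continuous_on_compose2[OF that]) (auto intro!: continuous_intros)
    have "continuous_on (?I \<times> {t..T})
        (\<lambda>z. case (snd z, p (snd z) + fst z *\<^sub>R q (snd z)) of (s, x) \<Rightarrow> N' s x)"
      by (rule continuous_on_compose2[OF N'])
        (use in_U in \<open>auto intro!: continuous_intros c p(1) q\<close>)
    from continuous_on_inner[OF this c[OF q]]
    show "continuous_on (?I \<times> cbox t T) (\<lambda>(\<epsilon>, s). N' s (p s + \<epsilon> *\<^sub>R q s) \<bullet> q s)"
      by (simp add: case_prod_beta)
  qed (use \<delta>(1) in auto)
  moreover have "at 0 within ?I = at 0" by (rule at_within_open) (use \<delta>(1) in auto)
  ultimately show ?thesis by simp
qed

lemma vector_derivative_component: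
  fixes c :: "real \<Rightarrow> real^'n"
  assumes "t < T" "s \<in> {t..T}" "(c has_vector_derivative c') (at s within {t..T})"
  shows "vector_derivative (\<lambda>r. c r $ i) (at s within {t..T}) = c' $ i"
  by (rule vector_derivative_within_closed_interval[OF assms(1,2)])
    (rule bounded_linear.has_vector_derivative[OF bounded_linear_vec_nth assms(3)])

lemma has_vector_derivative_vec_iff:
  fixes c :: "real \<Rightarrow> real^'n"
  shows "(c has_vector_derivative c') F \<longleftrightarrow>
    (\<forall>i. ((\<lambda>r. c r $ i) has_real_derivative c' $ i) F)"
proof
  assume "(c has_vector_derivative c') F"
  then show "\<forall>i. ((\<lambda>r. c r $ i) has_real_derivative c' $ i) F"
    by (auto simp: has_real_derivative_iff_has_vector_derivative
        intro: bounded_linear.has_vector_derivative[OF bounded_linear_vec_nth])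
next
  assume c: "\<forall>i. ((\<lambda>r. c r $ i) has_real_derivative c' $ i) F"
  have "((\<lambda>r. \<Sum>i\<in>UNIV. c r $ i *\<^sub>R axis i (1 :: real)) has_vector_derivative
      (\<Sum>i\<in>UNIV. c' $ i *\<^sub>R axis i 1)) F"
    by (rule has_vector_derivative_sum,
        rule bounded_linear.has_vector_derivative[OF bounded_linear_scaleR_left])
      (use c in \<open>simp flip: has_real_derivative_iff_has_vector_derivative\<close>)
  then show "(c has_vector_derivative c') F"
    by (simp add: basis_expansion flip: scalar_mult_eq_scaleR)
qed

lemma partial_deriv_cong_on_open:
  assumes "open U" "x \<in> U" and eq: "\<And>y. y \<in> U \<Longrightarrow> f y = g y"
  shows "partial_deriv k f x = partial_deriv k g x"
proof -
  have "\<forall>\<^sub>F h in nhds 0. x + h *\<^sub>R axis k 1 \<in> U"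
    by (rule topological_tendstoD[OF _ assms(1)])
      (use assms(2) in \<open>auto intro!: tendsto_eq_intros filterlim_ident\<close>)
  then have "\<forall>\<^sub>F h in nhds 0. f (x + h *\<^sub>R axis k 1) = g (x + h *\<^sub>R axis k 1)"
    by eventually_elim (rule eq)
  then show ?thesis unfolding partial_deriv_def by (rule deriv_cong_ev) simp
qed

section \<open>The control problem on a symmetric weighted graph\<close>

text \<open>The edge activations are described by the properties that the variations use: symmetry, positivity
  and smoothness near the curve, and dependence of \<open>\<Theta> i j\<close> on the coordinates \<open>i\<close> and \<open>j\<close> alone. The open set \<open>U\<close> is a
  common domain on which all coefficients are \<open>C\<^sup>1\<close>; it contains the density curve, and also its small
  perturbations, which in general leave the simplex.\<close>

locale graph_control_problem =
  fixes \<omega> :: "'n::finite \<Rightarrow> 'n \<Rightarrow> real" and \<Theta> :: "'n \<Rightarrow> 'n \<Rightarrow> real^'n \<Rightarrow> real"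
    and L :: "'n \<Rightarrow> 'n \<Rightarrow> real \<Rightarrow> real" and F G :: "real^'n \<Rightarrow> real"
    and t T :: real and U :: "(real^'n) set"
  assumes \<omega>_sym: "\<omega> i j = \<omega> j i"
    and \<Theta>_sym: "x \<in> U \<Longrightarrow> \<Theta> i j x = \<Theta> j i x"
    and \<Theta>_pos: "x \<in> U \<Longrightarrow> 0 < \<Theta> i j x"
    and \<Theta>_local: "k \<noteq> i \<Longrightarrow> k \<noteq> j \<Longrightarrow> \<Theta> i j (x + h *\<^sub>R axis k 1) = \<Theta> i j x"
    and \<Theta>_C1: "C1_on U (\<Theta> i j)"
    and L: "edge_lagrangians (edges \<omega>) L"
    and F_C1: "C1_on U F" and G_C1: "C1_on U G"
    and tT: "t < T"
begin

abbreviation H :: "'n \<Rightarrow> 'n \<Rightarrow> real \<Rightarrow> real" where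
  "H i j \<equiv> convex_conjugate (L i j)"

text \<open>This is the expression \<open>a b - L a\<close> of the convex conjugate, with the graph gradient of the
  multiplier as \<open>b\<close> and the velocity as \<open>a\<close>.\<close>

definition edge_gain :: "real^'n \<Rightarrow> ('n \<Rightarrow> 'n \<Rightarrow> real) \<Rightarrow> 'n \<Rightarrow> 'n \<Rightarrow> real" where
  "edge_gain \<phi> u i j = graph_grad \<omega> \<phi> i j * u i j - L i j (u i j)"

definition legendre_density :: "real^'n \<Rightarrow> ('n \<Rightarrow> 'n \<Rightarrow> real) \<Rightarrow> real^'n \<Rightarrow> real" where
  "legendre_density \<phi> u x = F x + 1/2 * (\<Sum>(i, j)\<in>edges \<omega>. \<Theta> i j x * edge_gain \<phi> u i j)"

definition legendre_density_grad :: "real^'n \<Rightarrow> ('n \<Rightarrow> 'n \<Rightarrow> real) \<Rightarrow> real^'n \<Rightarrow> real^'n" where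
  "legendre_density_grad \<phi> u x =
     gradient F x + (1/2) *\<^sub>R (\<Sum>(i, j)\<in>edges \<omega>. edge_gain \<phi> u i j *\<^sub>R gradient (\<Theta> i j) x)"

lemma open_U: "open U"
  using F_C1 by (simp add: C1_on_def)

lemma finite_edges [simp]: "finite (edges \<omega>)"
  by (rule finite_subset[OF subset_UNIV]) simp

lemma edges_sym: "(i, j) \<in> edges \<omega> \<longleftrightarrow> (j, i) \<in> edges \<omega>"
  using \<omega>_sym[of i j] by (auto simp: edges_def)

lemma L_edge:
  assumes "(i, j) \<in> edges \<omega>"
  shows "strictly_convex (L i j)" "superlinear (L i j)" "L i j a = L j i a" "L i j (- a) = L i j a"
  using L assms unfolding edge_lagrangians_def by auto

lemma H_sym: "(i, j) \<in> edges \<omega> \<Longrightarrow> H i j = H j i"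
  using L_edge(3)[of i j] by (simp add: fun_eq_iff convex_conjugate_def)

lemma graph_grad_antisym: "graph_grad \<omega> \<phi> i j = - graph_grad \<omega> \<phi> j i"
  using \<omega>_sym[of i j] by (simp add: graph_grad_def algebra_simps)

lemma sum_nbrs: "(\<Sum>i\<in>UNIV. \<Sum>j\<in>nbrs \<omega> i. f i j) = (\<Sum>(i, j)\<in>edges \<omega>. f i j)"
proof -
  have "(SIGMA i:UNIV. nbrs \<omega> i) = edges \<omega>" by (auto simp: nbrs_def)
  then show ?thesis by (simp add: sum.Sigma)
qed

lemma sum_edges_swap: "(\<Sum>(i, j)\<in>edges \<omega>. f i j) = (\<Sum>(i, j)\<in>edges \<omega>. f j i)"
  by (rule sum.reindex_bij_witness[of _ prod.swap prod.swap]) (auto simp: edges_sym[symmetric])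

text \<open>Every undirected edge occurs twice, with opposite values of \<open>m\<close>; averaging the two occurrences
  replaces \<open>\<phi> $ i\<close> by half of \<open>\<phi> $ i - \<phi> $ j\<close>.\<close>

lemma discrete_integration_by_parts:
  assumes "\<And>i j. (i, j) \<in> edges \<omega> \<Longrightarrow> m i j = - m j i"
  shows "(\<Sum>i\<in>UNIV. \<phi> $ i * (\<Sum>j\<in>nbrs \<omega> i. sqrt (\<omega> i j) * m i j)) =
    - (1/2) * (\<Sum>(i, j)\<in>edges \<omega>. graph_grad \<omega> \<phi> i j * m i j)"
proof -
  let ?S = "\<Sum>(i, j)\<in>edges \<omega>. \<phi> $ i * (sqrt (\<omega> i j) * m i j)"
  have "?S = (\<Sum>(i, j)\<in>edges \<omega>. \<phi> $ j * (sqrt (\<omega> j i) * m j i))"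
    by (rule sum_edges_swap)
  also have "\<dots> = (\<Sum>(i, j)\<in>edges \<omega>. - (\<phi> $ j * (sqrt (\<omega> i j) * m i j)))"
  proof (rule sum.cong[OF refl])
    show "(case e of (i, j) \<Rightarrow> \<phi> $ j * (sqrt (\<omega> j i) * m j i)) =
        (case e of (i, j) \<Rightarrow> - (\<phi> $ j * (sqrt (\<omega> i j) * m i j)))" if "e \<in> edges \<omega>" for e
      using that assms[of "fst e" "snd e"] \<omega>_sym[of "fst e" "snd e"] by (auto split: prod.splits)
  qed
  finally have "?S + ?S = (\<Sum>(i, j)\<in>edges \<omega>. \<phi> $ i * (sqrt (\<omega> i j) * m i j)) +
      (\<Sum>(i, j)\<in>edges \<omega>. - (\<phi> $ j * (sqrt (\<omega> i j) * m i j)))" by simp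
  also have "\<dots> = - (\<Sum>(i, j)\<in>edges \<omega>. graph_grad \<omega> \<phi> i j * m i j)"
    by (simp add: graph_grad_def case_prod_beta algebra_simps flip: sum.distrib sum_negf)
  finally have "?S = - (1/2) * (\<Sum>(i, j)\<in>edges \<omega>. graph_grad \<omega> \<phi> i j * m i j)" by linarith
  moreover have "(\<Sum>i\<in>UNIV. \<phi> $ i * (\<Sum>j\<in>nbrs \<omega> i. sqrt (\<omega> i j) * m i j)) = ?S"
    unfolding sum_distrib_left by (rule sum_nbrs)
  ultimately show ?thesis by simp
qed

lemma velocity_field_continuous:
  "velocity_field \<omega> t T v \<Longrightarrow> (i, j) \<in> edges \<omega> \<Longrightarrow> continuous_on {t..T} (\<lambda>s. v s i j)"
  unfolding velocity_field_def by blast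

lemma velocity_field_antisym:
  "velocity_field \<omega> t T v \<Longrightarrow> (i, j) \<in> edges \<omega> \<Longrightarrow> s \<in> {t..T} \<Longrightarrow> v s i j = - v s j i"
  unfolding velocity_field_def by blast

lemma velocity_field_combine:
  assumes "velocity_field \<omega> t T v" "velocity_field \<omega> t T w"
  shows "velocity_field \<omega> t T (\<lambda>s i j. v s i j + \<epsilon> * w s i j)"
  unfolding velocity_field_def
  using velocity_field_antisym[OF assms(1)] velocity_field_antisym[OF assms(2)]
  by (auto intro!: continuous_intros velocity_field_continuous[OF assms(1)]
      velocity_field_continuous[OF assms(2)])

section \<open>The Legendre form of the Lagrange functional\<close>

lemma continuous_on_graph_grad:
  "continuous_on S \<Phi> \<Longrightarrow> continuous_on S (\<lambda>s. graph_grad \<omega> (\<Phi> s) i j)"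
  unfolding graph_grad_def by (intro continuous_intros)

lemma edge_gain_le: "(i, j) \<in> edges \<omega> \<Longrightarrow> edge_gain \<phi> u i j \<le> H i j (graph_grad \<omega> \<phi> i j)"
  using young_inequality[OF L_edge(1,2), of i j "u i j" "graph_grad \<omega> \<phi> i j"]
  by (simp add: edge_gain_def mult.commute)

lemma edge_gain_eq_iff:
  "(i, j) \<in> edges \<omega> \<Longrightarrow> edge_gain \<phi> u i j = H i j (graph_grad \<omega> \<phi> i j) \<longleftrightarrow>
    u i j = deriv (H i j) (graph_grad \<omega> \<phi> i j)"
  using young_equality_iff[OF L_edge(1,2), of i j "u i j" "graph_grad \<omega> \<phi> i j"]
  by (simp add: edge_gain_def mult.commute)

lemma continuous_on_edge_gain:
  assumes "continuous_on {t..T} \<Phi>" "velocity_field \<omega> t T v" "(i, j) \<in> edges \<omega>"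
  shows "continuous_on {t..T} (\<lambda>s. edge_gain (\<Phi> s) (v s) i j)"
  unfolding edge_gain_def
  by (intro continuous_intros continuous_on_graph_grad assms(1)
      velocity_field_continuous[OF assms(2,3)]
      continuous_on_compose2[OF strictly_convex_continuous[OF L_edge(1)[OF assms(3)]]
        velocity_field_continuous[OF assms(2,3)]]) simp

lemma continuous_on_legendre_density:
  assumes "continuous_on {t..T} \<Phi>" "velocity_field \<omega> t T v"
  shows "continuous_on ({t..T} \<times> U) (\<lambda>(s, x). legendre_density (\<Phi> s) (v s) x)"
    and "continuous_on ({t..T} \<times> U) (\<lambda>(s, x). legendre_density_grad (\<Phi> s) (v s) x)"
proof -
  have sp: "continuous_on ({t..T} \<times> U) (\<lambda>z. h (snd z))" if "continuous_on U h"
    for h :: "real^'n \<Rightarrow> 'b::topological_space"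
    by (rule continuous_on_compose2[OF that]) (auto intro!: continuous_intros)
  have ti: "continuous_on ({t..T} \<times> U) (\<lambda>z. edge_gain (\<Phi> (fst z)) (v (fst z)) i j)"
    if "(i, j) \<in> edges \<omega>" for i j
    by (rule continuous_on_compose2[OF continuous_on_edge_gain[OF assms that]])
      (auto intro!: continuous_intros)
  show "continuous_on ({t..T} \<times> U) (\<lambda>(s, x). legendre_density (\<Phi> s) (v s) x)"
    unfolding legendre_density_def case_prod_beta
    by (intro continuous_intros sp C1_on_continuous[OF F_C1] C1_on_continuous[OF \<Theta>_C1] ti) simp
  show "continuous_on ({t..T} \<times> U) (\<lambda>(s, x). legendre_density_grad (\<Phi> s) (v s) x)"
    unfolding legendre_density_grad_def case_prod_beta
    by (intro continuous_intros sp C1_on_continuous_gradient[OF F_C1]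
        C1_on_continuous_gradient[OF \<Theta>_C1] ti) simp
qed

lemma legendre_density_has_derivative:
  assumes "x \<in> U"
  shows "(legendre_density \<phi> u has_derivative (\<lambda>h. legendre_density_grad \<phi> u x \<bullet> h)) (at x)"
proof -
  have "((\<lambda>x. F x + 1/2 * (\<Sum>e\<in>edges \<omega>. \<Theta> (fst e) (snd e) x * edge_gain \<phi> u (fst e) (snd e)))
      has_derivative (\<lambda>h. gradient F x \<bullet> h + 1/2 * (\<Sum>e\<in>edges \<omega>.
        (gradient (\<Theta> (fst e) (snd e)) x \<bullet> h) * edge_gain \<phi> u (fst e) (snd e)))) (at x)"
    by (intro has_derivative_add has_derivative_mult_right has_derivative_sum
        has_derivative_mult_left C1_on_has_gradient[OF F_C1 assms]
        C1_on_has_gradient[OF \<Theta>_C1 assms])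
  then show ?thesis
    unfolding legendre_density_def[abs_def] legendre_density_grad_def case_prod_beta
    by (rule has_derivative_eq_rhs)
      (simp add: fun_eq_iff inner_add_left inner_sum_left mult.commute)
qed

text \<open>By symmetry and locality of the activations, the edges touching \<open>k\<close> are those starting in \<open>k\<close> and
  their reversals, both contributing the same; the factor \<open>1/2\<close> cancels this double counting.\<close>

lemma legendre_density_grad_component:
  assumes x: "x \<in> U" and sym: "\<And>i j. (i, j) \<in> edges \<omega> \<Longrightarrow> edge_gain \<phi> u i j = edge_gain \<phi> u j i"
  shows "legendre_density_grad \<phi> u x $ k =
    (\<Sum>j\<in>nbrs \<omega> k. edge_gain \<phi> u k j * partial_deriv k (\<Theta> k j) x) + partial_deriv k F x"
proof -
  define f where "f i j = edge_gain \<phi> u i j * partial_deriv k (\<Theta> i j) x" for i j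
  have f_sym: "f i j = f j i" if "(i, j) \<in> edges \<omega>" for i j
    using partial_deriv_cong_on_open[OF open_U x, of "\<Theta> i j" "\<Theta> j i" k] \<Theta>_sym
    by (simp add: f_def sym[OF that])
  have f_local: "f i j = 0" if "k \<noteq> i" "k \<noteq> j" for i j
    by (simp add: f_def partial_deriv_def \<Theta>_local[OF that])
  have "(\<Sum>(i, j)\<in>edges \<omega>. f i j) =
      (\<Sum>(i, j)\<in>edges \<omega>. (if i = k then f i j else 0) + (if j = k then f i j else 0))"
    by (rule sum.cong[OF refl]) (auto simp: f_local edges_def)
  also have "\<dots> = (\<Sum>(i, j)\<in>edges \<omega>. if i = k then f i j else 0) +
      (\<Sum>(i, j)\<in>edges \<omega>. if j = k then f i j else 0)"
    by (simp add: case_prod_beta sum.distrib)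
  also have "(\<Sum>(i, j)\<in>edges \<omega>. if j = k then f i j else 0) =
      (\<Sum>(i, j)\<in>edges \<omega>. if i = k then f j i else 0)"
    by (rule sum_edges_swap)
  also have "\<dots> = (\<Sum>(i, j)\<in>edges \<omega>. if i = k then f i j else 0)"
    by (rule sum.cong[OF refl]) (auto simp: f_sym)
  also have "\<dots> = (\<Sum>i\<in>UNIV. \<Sum>j\<in>nbrs \<omega> i. if i = k then f i j else 0)"
    by (rule sum_nbrs[symmetric])
  also have "\<dots> = (\<Sum>i\<in>UNIV. if i = k then \<Sum>j\<in>nbrs \<omega> i. f i j else 0)"
    by (rule sum.cong[OF refl]) simp
  also have "\<dots> = (\<Sum>j\<in>nbrs \<omega> k. f k j)" by simp
  finally show ?thesis
    by (simp add: legendre_density_grad_def gradient_def f_def case_prod_beta)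
qed


lemma edge_gain_sym:
  assumes "velocity_field \<omega> t T v" "s \<in> {t..T}" "(i, j) \<in> edges \<omega>"
  shows "edge_gain \<phi> (v s) i j = edge_gain \<phi> (v s) j i"
  using L_edge(3)[OF assms(3)] L_edge(4)[of j i] assms(3) edges_sym[of i j]
  by (simp add: edge_gain_def velocity_field_antisym[OF assms(1,3,2)] graph_grad_antisym[of \<phi> i j])

lemma continuity_residual_eq:
  assumes "s \<in> {t..T}" "(p has_vector_derivative p') (at s within {t..T})"
  shows "continuity_residual \<omega> \<Theta> t T p v s i =
    p' $ i + (\<Sum>j\<in>nbrs \<omega> i. sqrt (\<omega> i j) * (v s i j * \<Theta> i j (p s)))"
  using vector_derivative_component[OF tT assms]
  by (simp add: continuity_residual_def mult.assoc)

text \<open>By discrete integration by parts the flux term of the constraint becomes the product of graph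
  gradient and velocity, weighted by the activation like the Lagrangian cost; the two combine into
  the edge gain, and of the constraint only the pairing with \<open>p'\<close> is left.\<close>

lemma lagrange_functional_legendre_form:
  assumes p: "\<And>s. s \<in> {t..T} \<Longrightarrow> (p has_vector_derivative p' s) (at s within {t..T})"
    and p': "continuous_on {t..T} p'" and pU: "\<And>s. s \<in> {t..T} \<Longrightarrow> p s \<in> U"
    and v: "velocity_field \<omega> t T v" and \<Phi>: "continuous_on {t..T} \<Phi>"
  shows "lagrange_functional \<omega> \<Theta> L F G t T p v \<Phi> =
    G (p T) + integral {t..T} (\<lambda>s. legendre_density (\<Phi> s) (v s) (p s)) -
    integral {t..T} (\<lambda>s. \<Phi> s \<bullet> p' s)"
proof -
  define l where "l s = 1/2 * (\<Sum>(i, j)\<in>edges \<omega>. \<Theta> i j (p s) * L i j (v s i j)) - F (p s)" for s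
  define c where "c s = (\<Sum>i\<in>UNIV. \<Phi> s $ i * continuity_residual \<omega> \<Theta> t T p v s i)" for s
  define d where "d s = legendre_density (\<Phi> s) (v s) (p s)" for s
  have p_cont: "continuous_on {t..T} p" using p by (rule continuous_on_vector_derivative)
  have along: "continuous_on {t..T} (\<lambda>s. f (p s))" if "C1_on U f" for f
    by (rule continuous_on_compose2[OF C1_on_continuous[OF that] p_cont]) (use pU in auto)
  have "continuous_on {t..T} l"
    unfolding l_def case_prod_beta
    by (intro continuous_intros along F_C1 \<Theta>_C1
        continuous_on_compose2[OF strictly_convex_continuous[OF L_edge(1)]]
        velocity_field_continuous[OF v]) auto
  then have l: "l integrable_on {t..T}" by (rule integrable_continuous_interval)
  have "continuous_on {t..T} (\<lambda>s. case (s, p s) of (s, x) \<Rightarrow> legendre_density (\<Phi> s) (v s) x)"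
    by (rule continuous_on_compose2[OF continuous_on_legendre_density(1)[OF \<Phi> v]])
      (use pU in \<open>auto intro!: continuous_intros p_cont\<close>)
  then have d: "d integrable_on {t..T}"
    unfolding d_def by (intro integrable_continuous_interval) simp
  have e: "(\<lambda>s. \<Phi> s \<bullet> p' s) integrable_on {t..T}"
    by (intro integrable_continuous_interval continuous_intros \<Phi> p')
  have c_eq: "c s = \<Phi> s \<bullet> p' s - d s - l s" if s: "s \<in> {t..T}" for s
  proof -
    have rearrange: "a = x - (f + 1/2 * y) - (1/2 * z - f)" if "a = x + - (1/2) * (y + z)"
      for a x y z f :: real using that by (simp add: field_simps)
    have "c s = \<Phi> s \<bullet> p' s +
        (\<Sum>i\<in>UNIV. \<Phi> s $ i * (\<Sum>j\<in>nbrs \<omega> i. sqrt (\<omega> i j) * (v s i j * \<Theta> i j (p s))))"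
      by (simp add: c_def continuity_residual_eq[OF s p[OF s]] inner_vec_def distrib_left sum.distrib)
    also have "(\<Sum>i\<in>UNIV. \<Phi> s $ i * (\<Sum>j\<in>nbrs \<omega> i. sqrt (\<omega> i j) * (v s i j * \<Theta> i j (p s)))) =
        - (1/2) * (\<Sum>(i, j)\<in>edges \<omega>. graph_grad \<omega> (\<Phi> s) i j * (v s i j * \<Theta> i j (p s)))"
      by (rule discrete_integration_by_parts)
        (use velocity_field_antisym[OF v _ s] \<Theta>_sym[OF pU[OF s]] in
          \<open>metis minus_mult_left\<close>)
    also have "(\<Sum>(i, j)\<in>edges \<omega>. graph_grad \<omega> (\<Phi> s) i j * (v s i j * \<Theta> i j (p s))) =
        (\<Sum>(i, j)\<in>edges \<omega>. \<Theta> i j (p s) * edge_gain (\<Phi> s) (v s) i j) +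
        (\<Sum>(i, j)\<in>edges \<omega>. \<Theta> i j (p s) * L i j (v s i j))"
      by (simp add: edge_gain_def case_prod_beta algebra_simps flip: sum.distrib)
    finally show ?thesis
      unfolding d_def l_def legendre_density_def by (rule rearrange)
  qed
  have "integral {t..T} c = integral {t..T} (\<lambda>s. \<Phi> s \<bullet> p' s - d s - l s)"
    by (rule integral_cong) (rule c_eq)
  also have "\<dots> = integral {t..T} (\<lambda>s. \<Phi> s \<bullet> p' s) - integral {t..T} d - integral {t..T} l"
    by (simp add: integral_diff integrable_diff d e l)
  finally show ?thesis
    unfolding lagrange_functional_def objective_def
    by (simp add: c_def[abs_def] d_def[abs_def] l_def[abs_def])
qed

section \<open>Stationarity in the velocity\<close>

definition feedback_velocity :: "(real \<Rightarrow> real^'n) \<Rightarrow> real \<Rightarrow> 'n \<Rightarrow> 'n \<Rightarrow> real" where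
  "feedback_velocity \<Phi> s i j = deriv (H i j) (graph_grad \<omega> (\<Phi> s) i j)"

lemma feedback_velocity_field:
  assumes "continuous_on {t..T} \<Phi>"
  shows "velocity_field \<omega> t T (feedback_velocity \<Phi>)"
  unfolding velocity_field_def
proof (clarify, intro conjI ballI)
  fix i j assume e: "(i, j) \<in> edges \<omega>"
  show "continuous_on {t..T} (\<lambda>s. feedback_velocity \<Phi> s i j)"
    unfolding feedback_velocity_def
    by (rule continuous_on_compose2[OF continuous_on_deriv_convex_conjugate[OF L_edge(1,2)[OF e], of UNIV]
          continuous_on_graph_grad[OF assms]]) simp
  show "feedback_velocity \<Phi> s i j = - feedback_velocity \<Phi> s j i" if "s \<in> {t..T}" for s
    unfolding feedback_velocity_def graph_grad_antisym[of _ i j] H_sym[OF e]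
    using e by (intro deriv_convex_conjugate_odd L_edge) (auto simp: edges_sym)
qed

lemma legendre_density_concave:
  assumes "x \<in> U" "0 \<le> r" "r \<le> 1"
  shows "(1 - r) * legendre_density \<phi> u x + r * legendre_density \<phi> w x
    \<le> legendre_density \<phi> (\<lambda>i j. (1 - r) * u i j + r * w i j) x"
proof -
  have average: "(1 - r) * (f + 1/2 * a) + r * (f + 1/2 * b) = f + 1/2 * ((1 - r) * a + r * b)"
    for f a b :: real by (simp add: field_simps)
  have "(1 - r) * edge_gain \<phi> u i j + r * edge_gain \<phi> w i j
      \<le> edge_gain \<phi> (\<lambda>i j. (1 - r) * u i j + r * w i j) i j" if "(i, j) \<in> edges \<omega>" for i j
    using convex_onD[OF strictly_convex_imp_convex_on[OF L_edge(1)[OF that]] assms(2,3),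
        of "u i j" "w i j"]
    by (simp add: edge_gain_def algebra_simps)
  then have "(\<Sum>e\<in>edges \<omega>. \<Theta> (fst e) (snd e) x *
        ((1 - r) * edge_gain \<phi> u (fst e) (snd e) + r * edge_gain \<phi> w (fst e) (snd e)))
      \<le> (\<Sum>e\<in>edges \<omega>. \<Theta> (fst e) (snd e) x *
        edge_gain \<phi> (\<lambda>i j. (1 - r) * u i j + r * w i j) (fst e) (snd e))"
    by (intro sum_mono mult_left_mono less_imp_le[OF \<Theta>_pos[OF assms(1)]]) auto
  also have "(\<Sum>e\<in>edges \<omega>. \<Theta> (fst e) (snd e) x *
        ((1 - r) * edge_gain \<phi> u (fst e) (snd e) + r * edge_gain \<phi> w (fst e) (snd e))) =
      (1 - r) * (\<Sum>e\<in>edges \<omega>. \<Theta> (fst e) (snd e) x * edge_gain \<phi> u (fst e) (snd e)) +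
      r * (\<Sum>e\<in>edges \<omega>. \<Theta> (fst e) (snd e) x * edge_gain \<phi> w (fst e) (snd e))"
    unfolding sum_distrib_left sum.distrib[symmetric]
    by (rule sum.cong[OF refl]) (simp add: algebra_simps)
  finally show ?thesis
    unfolding legendre_density_def case_prod_beta average
    by (intro add_left_mono mult_left_mono) simp_all
qed

lemma legendre_density_gap:
  "legendre_density (\<Phi> s) (feedback_velocity \<Phi> s) x - legendre_density (\<Phi> s) u x =
    1/2 * (\<Sum>(i, j)\<in>edges \<omega>. \<Theta> i j x *
      (H i j (graph_grad \<omega> (\<Phi> s) i j) - edge_gain (\<Phi> s) u i j))"
proof -
  have "edge_gain (\<Phi> s) (feedback_velocity \<Phi> s) i j = H i j (graph_grad \<omega> (\<Phi> s) i j)"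
    if "(i, j) \<in> edges \<omega>" for i j
    using edge_gain_eq_iff[OF that] by (simp add: feedback_velocity_def)
  then show ?thesis
    by (simp add: legendre_density_def case_prod_beta right_diff_distrib sum_subtractf)
qed

lemma legendre_density_le_feedback:
  assumes "x \<in> U"
  shows "legendre_density (\<Phi> s) u x \<le> legendre_density (\<Phi> s) (feedback_velocity \<Phi> s) x"
proof -
  have "0 \<le> (\<Sum>(i, j)\<in>edges \<omega>. \<Theta> i j x *
      (H i j (graph_grad \<omega> (\<Phi> s) i j) - edge_gain (\<Phi> s) u i j))"
    using edge_gain_le less_imp_le[OF \<Theta>_pos[OF assms]] by (intro sum_nonneg) auto
  then show ?thesis using legendre_density_gap[of \<Phi> s x u] by linarith
qed

text \<open>The gap between the two sides is a sum of nonnegative terms, the defects in Young's inequality on the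
  edges with positive weights.\<close>

lemma legendre_density_eq_feedback_iff:
  assumes "x \<in> U"
  shows "legendre_density (\<Phi> s) u x = legendre_density (\<Phi> s) (feedback_velocity \<Phi> s) x \<longleftrightarrow>
    (\<forall>(i, j)\<in>edges \<omega>. u i j = feedback_velocity \<Phi> s i j)"
proof -
  have "legendre_density (\<Phi> s) u x = legendre_density (\<Phi> s) (feedback_velocity \<Phi> s) x \<longleftrightarrow>
      (\<Sum>(i, j)\<in>edges \<omega>. \<Theta> i j x *
        (H i j (graph_grad \<omega> (\<Phi> s) i j) - edge_gain (\<Phi> s) u i j)) = 0"
    using legendre_density_gap[of \<Phi> s x u] by linarith
  also have "\<dots> \<longleftrightarrow> (\<forall>e\<in>edges \<omega>. (case e of (i, j) \<Rightarrow> \<Theta> i j x *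
        (H i j (graph_grad \<omega> (\<Phi> s) i j) - edge_gain (\<Phi> s) u i j)) = 0)"
    by (rule sum_nonneg_eq_0_iff)
      (use edge_gain_le less_imp_le[OF \<Theta>_pos[OF assms]] in auto)
  also have "\<dots> \<longleftrightarrow> (\<forall>(i, j)\<in>edges \<omega>. u i j = feedback_velocity \<Phi> s i j)"
  proof (rule ball_cong[OF refl], clarify)
    fix i j assume e: "(i, j) \<in> edges \<omega>"
    show "(\<Theta> i j x * (H i j (graph_grad \<omega> (\<Phi> s) i j) - edge_gain (\<Phi> s) u i j) = 0) =
        (u i j = feedback_velocity \<Phi> s i j)"
      using edge_gain_eq_iff[OF e, of "\<Phi> s" u] \<Theta>_pos[OF assms, of i j]
      by (auto simp: feedback_velocity_def)
  qed
  finally show ?thesis .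
qed

text \<open>By concavity stationarity is maximality, and the test direction that leads from \<open>v\<close> to the feedback
  velocity suffices: along it the integrand can only grow, so a maximal \<open>v\<close> has the same integral, and
  by continuity the same integrand, as the feedback velocity.\<close>

theorem stationary_velocity_iff_feedback:
  assumes p: "\<And>s. s \<in> {t..T} \<Longrightarrow> (p has_vector_derivative p' s) (at s within {t..T})"
    and p': "continuous_on {t..T} p'" and pU: "\<And>s. s \<in> {t..T} \<Longrightarrow> p s \<in> U"
    and v: "velocity_field \<omega> t T v" and \<Phi>: "continuous_on {t..T} \<Phi>"
  shows "stationary_velocity \<omega> \<Theta> L F G t T p v \<Phi> \<longleftrightarrow> feedback_control \<omega> H t T v \<Phi>"
proof -
  define J where "J w \<epsilon> =
    lagrange_functional \<omega> \<Theta> L F G t T p (\<lambda>s i j. v s i j + \<epsilon> * w s i j) \<Phi>" for w \<epsilon>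
  define d where "d u s = legendre_density (\<Phi> s) (u s) (p s)" for u s
  define C where "C = G (p T) - integral {t..T} (\<lambda>s. \<Phi> s \<bullet> p' s)"
  have p_cont: "continuous_on {t..T} p" using p by (rule continuous_on_vector_derivative)
  have d_cont: "continuous_on {t..T} (d u)" if "velocity_field \<omega> t T u" for u
  proof -
    have "continuous_on {t..T} (\<lambda>s. case (s, p s) of (s, x) \<Rightarrow> legendre_density (\<Phi> s) (u s) x)"
      by (rule continuous_on_compose2[OF continuous_on_legendre_density(1)[OF \<Phi> that]])
        (use pU in \<open>auto intro!: continuous_intros p_cont\<close>)
    then show ?thesis by (simp add: d_def[abs_def])
  qed
  note d_int = integrable_continuous_interval[OF d_cont]
  have J_eq: "J w \<epsilon> = C + integral {t..T} (d (\<lambda>s i j. v s i j + \<epsilon> * w s i j))"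
    if "velocity_field \<omega> t T w" for w \<epsilon>
    unfolding J_def
    by (subst lagrange_functional_legendre_form[where p' = p'])
      (simp_all add: p p' pU velocity_field_combine[OF v that] \<Phi> C_def d_def[abs_def])
  have "concave_on UNIV (J w)" if w: "velocity_field \<omega> t T w" for w
  proof -
    let ?u = "\<lambda>\<epsilon> s i j. v s i j + \<epsilon> * w s i j"
    have vf: "velocity_field \<omega> t T (?u \<epsilon>)" for \<epsilon>
      by (rule velocity_field_combine[OF v w])
    show ?thesis
    proof (rule concave_on_linorderI)
      fix r x y :: real assume r: "0 < r" "r < 1"
      have "(1 - r) * integral {t..T} (d (?u x)) + r * integral {t..T} (d (?u y)) =
          integral {t..T} (\<lambda>s. (1 - r) * d (?u x) s + r * d (?u y) s)"
        using integral_add[OF integrable_on_mult_right[OF d_int[OF vf[of x]], of "1 - r"]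
            integrable_on_mult_right[OF d_int[OF vf[of y]], of r]] by simp
      also have "\<dots> \<le> integral {t..T} (d (?u ((1 - r) *\<^sub>R x + r *\<^sub>R y)))"
      proof (rule integral_le)
        show "(\<lambda>s. (1 - r) * d (?u x) s + r * d (?u y) s) integrable_on {t..T}"
          by (intro integrable_add integrable_on_mult_right d_int vf)
        fix s assume s: "s \<in> {t..T}"
        have "?u ((1 - r) *\<^sub>R x + r *\<^sub>R y) s = (\<lambda>i j. (1 - r) * ?u x s i j + r * ?u y s i j)"
          by (simp add: fun_eq_iff algebra_simps)
        then show "(1 - r) * d (?u x) s + r * d (?u y) s \<le> d (?u ((1 - r) *\<^sub>R x + r *\<^sub>R y)) s"
          using legendre_density_concave[OF pU[OF s], of r "\<Phi> s" "?u x s" "?u y s"] r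
          by (simp add: d_def)
      qed (rule d_int[OF vf])
      finally show "(1 - r) * J w x + r * J w y \<le> J w ((1 - r) *\<^sub>R x + r *\<^sub>R y)"
        by (simp add: J_eq[OF w] algebra_simps)
    qed simp
  qed
  then have "stationary_velocity \<omega> \<Theta> L F G t T p v \<Phi> \<longleftrightarrow>
      (\<forall>w. velocity_field \<omega> t T w \<longrightarrow> (\<forall>\<epsilon>\<ge>0. J w \<epsilon> \<le> J w 0))"
    unfolding stationary_velocity_def J_def[symmetric, abs_def]
    by (simp add: concave_right_derivative_nonpos_iff)
  also have "\<dots> \<longleftrightarrow> feedback_control \<omega> H t T v \<Phi>"
  proof
    assume max: "\<forall>w. velocity_field \<omega> t T w \<longrightarrow> (\<forall>\<epsilon>\<ge>0. J w \<epsilon> \<le> J w 0)"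
    let ?v = "feedback_velocity \<Phi>"
    have fb: "velocity_field \<omega> t T ?v" by (rule feedback_velocity_field[OF \<Phi>])
    \<comment> \<open>With this direction, \<open>\<epsilon> = 1\<close> reaches the feedback velocity.\<close>
    have w: "velocity_field \<omega> t T (\<lambda>s i j. ?v s i j + (- 1) * v s i j)"
      by (rule velocity_field_combine[OF fb v])
    have "integral {t..T} (d ?v) \<le> integral {t..T} (d v)"
      using max[rule_format, OF w, of 1] unfolding J_eq[OF w] by simp
    moreover have nonneg: "0 \<le> d ?v s - d v s" if "s \<in> {t..T}" for s
      using legendre_density_le_feedback[OF pU[OF that]] by (simp add: d_def)
    moreover have "integral {t..T} (\<lambda>s. d ?v s - d v s) = integral {t..T} (d ?v) - integral {t..T} (d v)"
      by (rule integral_diff[OF d_int[OF fb] d_int[OF v]])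
    moreover have "0 \<le> integral {t..T} (\<lambda>s. d ?v s - d v s)"
      by (rule integral_nonneg[OF integrable_diff[OF d_int[OF fb] d_int[OF v]]]) (rule nonneg)
    ultimately have "integral {t..T} (\<lambda>s. d ?v s - d v s) = 0" by linarith
    then have "\<forall>s\<in>{t..T}. d ?v s - d v s = 0"
      using integral_eq_0_iff[OF continuous_on_diff[OF d_cont[OF fb] d_cont[OF v]] tT] nonneg
      by blast
    then show "feedback_control \<omega> H t T v \<Phi>"
      unfolding feedback_control_def
      using legendre_density_eq_feedback_iff[OF pU, of _ \<Phi> _ "v _"]
      by (force simp: d_def feedback_velocity_def)
  next
    assume fb: "feedback_control \<omega> H t T v \<Phi>"
    show "\<forall>w. velocity_field \<omega> t T w \<longrightarrow> (\<forall>\<epsilon>\<ge>0. J w \<epsilon> \<le> J w 0)"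
    proof (intro allI impI)
      fix w and \<epsilon> :: real assume w: "velocity_field \<omega> t T w"
      have "integral {t..T} (d (\<lambda>s i j. v s i j + \<epsilon> * w s i j)) \<le> integral {t..T} (d v)"
      proof (rule integral_le[OF d_int[OF velocity_field_combine[OF v w]] d_int[OF v]])
        fix s assume s: "s \<in> {t..T}"
        have "\<forall>(i, j)\<in>edges \<omega>. v s i j = feedback_velocity \<Phi> s i j"
          using fb s by (auto simp: feedback_control_def feedback_velocity_def)
        then have "d v s = d (feedback_velocity \<Phi>) s"
          using legendre_density_eq_feedback_iff[OF pU[OF s], of \<Phi> s "v s"] by (simp add: d_def)
        then show "d (\<lambda>s i j. v s i j + \<epsilon> * w s i j) s \<le> d v s"
          using legendre_density_le_feedback[OF pU[OF s]] by (simp add: d_def)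
      qed
      then show "J w \<epsilon> \<le> J w 0" by (simp add: J_eq[OF w])
    qed
  qed
  finally show ?thesis .
qed

section \<open>Stationarity in the density and in the multiplier\<close>

text \<open>The Legendre form is available for all small perturbations of the curve. Differentiating it under
  the integral sign gives the first variation in the weak form of the du Bois-Reymond lemma.\<close>

theorem stationary_density_iff_adjoint:
  assumes p: "\<And>s. s \<in> {t..T} \<Longrightarrow> (p has_vector_derivative p' s) (at s within {t..T})"
    and p': "continuous_on {t..T} p'" and pU: "\<And>s. s \<in> {t..T} \<Longrightarrow> p s \<in> U"
    and v: "velocity_field \<omega> t T v" and \<Phi>: "continuous_on {t..T} \<Phi>"
  shows "stationary_density \<omega> \<Theta> L F G t T p v \<Phi> \<longleftrightarrow>
    (\<forall>s\<in>{t..T}. (\<Phi> has_vector_derivative - legendre_density_grad (\<Phi> s) (v s) (p s))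
        (at s within {t..T})) \<and> \<Phi> T = gradient G (p T)"
proof -
  define A where "A s = legendre_density_grad (\<Phi> s) (v s) (p s)" for s
  have p_cont: "continuous_on {t..T} p" using p by (rule continuous_on_vector_derivative)
  have "continuous_on {t..T} (\<lambda>s. case (s, p s) of (s, x) \<Rightarrow> legendre_density_grad (\<Phi> s) (v s) x)"
    by (rule continuous_on_compose2[OF continuous_on_legendre_density(2)[OF \<Phi> v]])
      (use pU in \<open>auto intro!: continuous_intros p_cont\<close>)
  then have A: "continuous_on {t..T} A" by (simp add: A_def[abs_def])
  have first_variation:
    "((\<lambda>\<epsilon>. lagrange_functional \<omega> \<Theta> L F G t T (\<lambda>s. p s + \<epsilon> *\<^sub>R q s) v \<Phi>) has_real_derivative
        gradient G (p T) \<bullet> q T + integral {t..T} (\<lambda>s. A s \<bullet> q s) -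
        integral {t..T} (\<lambda>s. \<Phi> s \<bullet> q' s)) (at 0)"
    if q: "\<And>s. s \<in> {t..T} \<Longrightarrow> (q has_vector_derivative q' s) (at s within {t..T})"
      and q': "continuous_on {t..T} q'" for q q'
  proof -
    have q_cont: "continuous_on {t..T} q" using q by (rule continuous_on_vector_derivative)
    obtain \<delta> where \<delta>: "0 < \<delta>" "\<And>\<epsilon> s. \<bar>\<epsilon>\<bar> < \<delta> \<Longrightarrow> s \<in> {t..T} \<Longrightarrow> p s + \<epsilon> *\<^sub>R q s \<in> U"
      using perturbed_curve_stays_in_open[OF open_U p_cont pU q_cont] by metis
    have "((\<lambda>\<epsilon>. p T + \<epsilon> *\<^sub>R q T) has_derivative (\<lambda>h. h *\<^sub>R q T)) (at 0)"
      by (auto intro!: derivative_eq_intros)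
    then have "((\<lambda>\<epsilon>. G (p T + \<epsilon> *\<^sub>R q T)) has_derivative
        (\<lambda>h. gradient G (p T) \<bullet> (h *\<^sub>R q T))) (at 0)"
      by (rule has_derivative_compose) (use C1_on_has_gradient[OF G_C1 pU] tT in simp)
    then have G: "((\<lambda>\<epsilon>. G (p T + \<epsilon> *\<^sub>R q T)) has_real_derivative gradient G (p T) \<bullet> q T) (at 0)"
      by (simp add: has_field_derivative_def mult_commute_abs)
    have "((\<lambda>\<epsilon>. integral {t..T} (\<lambda>s. legendre_density (\<Phi> s) (v s) (p s + \<epsilon> *\<^sub>R q s)))
        has_real_derivative integral {t..T} (\<lambda>s. legendre_density_grad (\<Phi> s) (v s) (p s) \<bullet> q s)) (at 0)"
      by (rule action_has_derivative_along[OF open_U p_cont pU q_cont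
            continuous_on_legendre_density[OF \<Phi> v] legendre_density_has_derivative])
    then have I: "((\<lambda>\<epsilon>. integral {t..T} (\<lambda>s. legendre_density (\<Phi> s) (v s) (p s + \<epsilon> *\<^sub>R q s)))
        has_real_derivative integral {t..T} (\<lambda>s. A s \<bullet> q s)) (at 0)"
      by (simp add: A_def)
    have "((\<lambda>\<epsilon>. G (p T + \<epsilon> *\<^sub>R q T) +
          integral {t..T} (\<lambda>s. legendre_density (\<Phi> s) (v s) (p s + \<epsilon> *\<^sub>R q s)) -
          (integral {t..T} (\<lambda>s. \<Phi> s \<bullet> p' s) + \<epsilon> * integral {t..T} (\<lambda>s. \<Phi> s \<bullet> q' s)))
        has_real_derivative gradient G (p T) \<bullet> q T + integral {t..T} (\<lambda>s. A s \<bullet> q s) -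
          (0 + 1 * integral {t..T} (\<lambda>s. \<Phi> s \<bullet> q' s))) (at 0)"
      by (intro DERIV_diff DERIV_add G I DERIV_const DERIV_cmult_right DERIV_ident)
    then have "((\<lambda>\<epsilon>. G (p T + \<epsilon> *\<^sub>R q T) +
          integral {t..T} (\<lambda>s. legendre_density (\<Phi> s) (v s) (p s + \<epsilon> *\<^sub>R q s)) -
          (integral {t..T} (\<lambda>s. \<Phi> s \<bullet> p' s) + \<epsilon> * integral {t..T} (\<lambda>s. \<Phi> s \<bullet> q' s)))
        has_real_derivative gradient G (p T) \<bullet> q T + integral {t..T} (\<lambda>s. A s \<bullet> q s) -
          integral {t..T} (\<lambda>s. \<Phi> s \<bullet> q' s)) (at 0)"
      by simp
    then show ?thesis
    proof (rule has_field_derivative_transform_within_open[of _ _ _ "{- \<delta><..<\<delta>}"])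
      fix \<epsilon> assume "\<epsilon> \<in> {- \<delta><..<\<delta>}"
      then have inU: "\<And>s. s \<in> {t..T} \<Longrightarrow> p s + \<epsilon> *\<^sub>R q s \<in> U" by (intro \<delta>) auto
      have pq: "((\<lambda>s. p s + \<epsilon> *\<^sub>R q s) has_vector_derivative p' s + \<epsilon> *\<^sub>R q' s) (at s within {t..T})"
        if "s \<in> {t..T}" for s
        using p[OF that] q[OF that] by (auto intro!: derivative_eq_intros)
      have "lagrange_functional \<omega> \<Theta> L F G t T (\<lambda>s. p s + \<epsilon> *\<^sub>R q s) v \<Phi> =
          G (p T + \<epsilon> *\<^sub>R q T) +
          integral {t..T} (\<lambda>s. legendre_density (\<Phi> s) (v s) (p s + \<epsilon> *\<^sub>R q s)) -
          integral {t..T} (\<lambda>s. \<Phi> s \<bullet> (p' s + \<epsilon> *\<^sub>R q' s))"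
        by (rule lagrange_functional_legendre_form[OF pq _ inU v \<Phi>])
          (auto intro!: continuous_intros p' q')
      also have "integral {t..T} (\<lambda>s. \<Phi> s \<bullet> (p' s + \<epsilon> *\<^sub>R q' s)) =
          integral {t..T} (\<lambda>s. \<Phi> s \<bullet> p' s) + \<epsilon> * integral {t..T} (\<lambda>s. \<Phi> s \<bullet> q' s)"
        unfolding inner_add_right inner_scaleR_right integral_mult_right[symmetric]
        by (intro integral_add integrable_continuous_interval continuous_intros \<Phi> p' q')
      finally show "G (p T + \<epsilon> *\<^sub>R q T) +
          integral {t..T} (\<lambda>s. legendre_density (\<Phi> s) (v s) (p s + \<epsilon> *\<^sub>R q s)) -
          (integral {t..T} (\<lambda>s. \<Phi> s \<bullet> p' s) + \<epsilon> * integral {t..T} (\<lambda>s. \<Phi> s \<bullet> q' s)) =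
          lagrange_functional \<omega> \<Theta> L F G t T (\<lambda>s. p s + \<epsilon> *\<^sub>R q s) v \<Phi>" by simp
    qed (use \<delta>(1) in auto)
  qed
  have vanish: "((\<lambda>\<epsilon>. lagrange_functional \<omega> \<Theta> L F G t T (\<lambda>s. p s + \<epsilon> *\<^sub>R q s) v \<Phi>)
        has_real_derivative 0) (at 0) \<longleftrightarrow>
      gradient G (p T) \<bullet> q T + integral {t..T} (\<lambda>s. A s \<bullet> q s) -
        integral {t..T} (\<lambda>s. \<Phi> s \<bullet> q' s) = 0"
    if q: "\<forall>s\<in>{t..T}. (q has_vector_derivative q' s) (at s within {t..T})"
      and q': "continuous_on {t..T} q'" for q q'
  proof -
    note D = first_variation[OF bspec[OF q] q']
    show ?thesis
    proof
      assume zero: "gradient G (p T) \<bullet> q T + integral {t..T} (\<lambda>s. A s \<bullet> q s) -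
        integral {t..T} (\<lambda>s. \<Phi> s \<bullet> q' s) = 0"
      show "((\<lambda>\<epsilon>. lagrange_functional \<omega> \<Theta> L F G t T (\<lambda>s. p s + \<epsilon> *\<^sub>R q s) v \<Phi>)
        has_real_derivative 0) (at 0)"
        using D unfolding zero .
    qed (rule DERIV_unique[OF D])
  qed
  have "stationary_density \<omega> \<Theta> L F G t T p v \<Phi> \<longleftrightarrow>
      (\<forall>q q'. (\<forall>s\<in>{t..T}. (q has_vector_derivative q' s) (at s within {t..T})) \<longrightarrow>
        continuous_on {t..T} q' \<longrightarrow> q t = 0 \<longrightarrow>
        gradient G (p T) \<bullet> q T + integral {t..T} (\<lambda>s. A s \<bullet> q s) -
          integral {t..T} (\<lambda>s. \<Phi> s \<bullet> q' s) = 0)" (is "_ \<longleftrightarrow> ?weak")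
  proof
    assume stat: "stationary_density \<omega> \<Theta> L F G t T p v \<Phi>"
    show ?weak
    proof (intro allI impI)
      fix q q' :: "real \<Rightarrow> real^'n"
      assume q: "\<forall>s\<in>{t..T}. (q has_vector_derivative q' s) (at s within {t..T})"
        and q': "continuous_on {t..T} q'" and "q t = 0"
      then have "C1_curve t T q \<and> q t = 0" unfolding C1_curve_def by (intro conjI exI)
      from stat[unfolded stationary_density_def, rule_format, OF this]
      show "gradient G (p T) \<bullet> q T + integral {t..T} (\<lambda>s. A s \<bullet> q s) -
          integral {t..T} (\<lambda>s. \<Phi> s \<bullet> q' s) = 0"
        unfolding vanish[OF q q'] .
    qed
  next
    assume weak: ?weak
    show "stationary_density \<omega> \<Theta> L F G t T p v \<Phi>"
      unfolding stationary_density_def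
    proof (intro allI impI, elim conjE)
      fix q :: "real \<Rightarrow> real^'n" assume "C1_curve t T q" and q0: "q t = 0"
      then obtain q' where q: "\<forall>s\<in>{t..T}. (q has_vector_derivative q' s) (at s within {t..T})"
          and q': "continuous_on {t..T} q'"
        unfolding C1_curve_def by (elim exE conjE)
      show "((\<lambda>\<epsilon>. lagrange_functional \<omega> \<Theta> L F G t T (\<lambda>s. p s + \<epsilon> *\<^sub>R q s) v \<Phi>)
          has_real_derivative 0) (at 0)"
        unfolding vanish[OF q q'] using weak q q' q0 by simp
    qed
  qed
  also have "\<dots> \<longleftrightarrow> (\<forall>s\<in>{t..T}. (\<Phi> has_vector_derivative - A s) (at s within {t..T})) \<and>
      \<Phi> T = gradient G (p T)"
    by (rule du_bois_reymond_free_end[OF tT \<Phi> A])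
  finally show ?thesis by (simp add: A_def)
qed

text \<open>The functional is affine in the multiplier, and the continuity residual is itself continuous and so
  an allowed test direction.\<close>

theorem stationary_multiplier_iff_continuity:
  assumes p: "\<And>s. s \<in> {t..T} \<Longrightarrow> (p has_vector_derivative p' s) (at s within {t..T})"
    and p': "continuous_on {t..T} p'" and pU: "\<And>s. s \<in> {t..T} \<Longrightarrow> p s \<in> U"
    and v: "velocity_field \<omega> t T v" and \<Phi>: "continuous_on {t..T} \<Phi>"
  shows "stationary_multiplier \<omega> \<Theta> L F G t T p v \<Phi> \<longleftrightarrow>
    (\<forall>s\<in>{t..T}. \<forall>i. continuity_residual \<omega> \<Theta> t T p v s i = 0)"
proof -
  define R :: "real \<Rightarrow> real^'n" where
    "R s = (\<chi> i. continuity_residual \<omega> \<Theta> t T p v s i)" for s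
  have p_cont: "continuous_on {t..T} p" using p by (rule continuous_on_vector_derivative)
  have \<Theta>p: "continuous_on {t..T} (\<lambda>s. \<Theta> i j (p s))" for i j
    by (rule continuous_on_compose2[OF C1_on_continuous[OF \<Theta>_C1] p_cont]) (use pU in auto)
  have "continuous_on {t..T} (\<lambda>s. \<chi> i. p' s $ i +
      (\<Sum>j\<in>nbrs \<omega> i. sqrt (\<omega> i j) * (v s i j * \<Theta> i j (p s))))"
    by (intro continuous_intros p' \<Theta>p velocity_field_continuous[OF v]) (simp add: nbrs_def)
  then have R: "continuous_on {t..T} R"
  proof (rule continuous_on_eq)
    fix s assume s: "s \<in> {t..T}"
    show "(\<chi> i. p' s $ i + (\<Sum>j\<in>nbrs \<omega> i. sqrt (\<omega> i j) * (v s i j * \<Theta> i j (p s)))) = R s"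
      unfolding R_def
      by (intro arg_cong[of _ _ vec_lambda] ext continuity_residual_eq[OF s p[OF s], symmetric])
  qed
  have split: "lagrange_functional \<omega> \<Theta> L F G t T p v (\<lambda>s. \<Phi> s + \<epsilon> *\<^sub>R \<Psi> s) =
      lagrange_functional \<omega> \<Theta> L F G t T p v \<Phi> - \<epsilon> * integral {t..T} (\<lambda>s. \<Psi> s \<bullet> R s)"
    if "continuous_on {t..T} \<Psi>" for \<Psi> \<epsilon>
  proof -
    have "integral {t..T} (\<lambda>s. (\<Phi> s + \<epsilon> *\<^sub>R \<Psi> s) \<bullet> R s) =
        integral {t..T} (\<lambda>s. \<Phi> s \<bullet> R s) + \<epsilon> * integral {t..T} (\<lambda>s. \<Psi> s \<bullet> R s)"
      unfolding inner_add_left inner_scaleR_left integral_mult_right[symmetric]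
      by (intro integral_add integrable_continuous_interval continuous_intros \<Phi> R that)
    then show ?thesis
      unfolding lagrange_functional_def by (simp add: inner_vec_def R_def)
  qed
  have "((\<lambda>\<epsilon>. lagrange_functional \<omega> \<Theta> L F G t T p v (\<lambda>s. \<Phi> s + \<epsilon> *\<^sub>R \<Psi> s))
      has_real_derivative 0) (at 0) \<longleftrightarrow> integral {t..T} (\<lambda>s. \<Psi> s \<bullet> R s) = 0"
    if \<Psi>: "continuous_on {t..T} \<Psi>" for \<Psi>
  proof -
    have "((\<lambda>\<epsilon>. lagrange_functional \<omega> \<Theta> L F G t T p v (\<lambda>s. \<Phi> s + \<epsilon> *\<^sub>R \<Psi> s))
      has_real_derivative - integral {t..T} (\<lambda>s. \<Psi> s \<bullet> R s)) (at 0)"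
      unfolding split[OF \<Psi>] by (auto intro!: derivative_eq_intros)
    from DERIV_unique[OF this] this show ?thesis by fastforce
  qed
  then have "stationary_multiplier \<omega> \<Theta> L F G t T p v \<Phi> \<longleftrightarrow>
      (\<forall>\<Psi>. continuous_on {t..T} \<Psi> \<longrightarrow> integral {t..T} (\<lambda>s. \<Psi> s \<bullet> R s) = 0)"
    unfolding stationary_multiplier_def by blast
  also have "\<dots> \<longleftrightarrow> (\<forall>s\<in>{t..T}. R s = 0)"
  proof
    assume "\<forall>\<Psi>. continuous_on {t..T} \<Psi> \<longrightarrow> integral {t..T} (\<lambda>s. \<Psi> s \<bullet> R s) = 0"
    then have "integral {t..T} (\<lambda>s. R s \<bullet> R s) = 0" using R by blast
    then have "\<forall>s\<in>{t..T}. R s \<bullet> R s = 0"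
      by (subst (asm) integral_eq_0_iff) (auto intro!: continuous_intros R tT)
    then show "\<forall>s\<in>{t..T}. R s = 0" by simp
  next
    assume "\<forall>s\<in>{t..T}. R s = 0"
    then have "integral {t..T} (\<lambda>s. \<Psi> s \<bullet> R s) = integral {t..T} (\<lambda>s. 0)" for \<Psi>
      by (intro integral_cong) simp
    then show "\<forall>\<Psi>. continuous_on {t..T} \<Psi> \<longrightarrow> integral {t..T} (\<lambda>s. \<Psi> s \<bullet> R s) = 0" by simp
  qed
  also have "\<dots> \<longleftrightarrow> (\<forall>s\<in>{t..T}. \<forall>i. continuity_residual \<omega> \<Theta> t T p v s i = 0)"
    by (simp add: R_def vec_eq_iff)
  finally show ?thesis .
qed

section \<open>The Hamiltonian system\<close>

text \<open>Under the feedback law every edge gain equals the Hamiltonian, by equality in Young's inequality.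
  This turns the equation obtained by varying the density into the equation for \<open>\<Phi>\<close>, while the
  continuity equation becomes the equation for \<open>p\<close> by substituting the velocity.\<close>

lemma hamiltonian_system_iff_under_feedback:
  assumes p: "\<And>s. s \<in> {t..T} \<Longrightarrow> (p has_vector_derivative p' s) (at s within {t..T})"
    and pU: "\<And>s. s \<in> {t..T} \<Longrightarrow> p s \<in> U"
    and v: "velocity_field \<omega> t T v" and fb: "feedback_control \<omega> H t T v \<Phi>"
  shows "hamiltonian_system \<omega> \<Theta> H F G t T p0 p \<Phi> \<longleftrightarrow>
    (\<forall>s\<in>{t..T}. \<forall>i. continuity_residual \<omega> \<Theta> t T p v s i = 0) \<and>
    (\<forall>s\<in>{t..T}. (\<Phi> has_vector_derivative - legendre_density_grad (\<Phi> s) (v s) (p s))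
        (at s within {t..T})) \<and> p t = p0 \<and> \<Phi> T = gradient G (p T)"
proof -
  have v_eq: "v s i j = deriv (H i j) (graph_grad \<omega> (\<Phi> s) i j)"
    if "s \<in> {t..T}" "j \<in> nbrs \<omega> i" for s i j
    using bspec[OF bspec[OF fb[unfolded feedback_control_def] that(1)], of "(i, j)"] that(2)
    by (simp add: nbrs_def)
  have flow: "((\<lambda>r. p r $ i) has_real_derivative - (\<Sum>j\<in>nbrs \<omega> i. sqrt (\<omega> i j) * \<Theta> i j (p s) *
        deriv (H i j) (graph_grad \<omega> (\<Phi> s) i j))) (at s within {t..T}) \<longleftrightarrow>
      continuity_residual \<omega> \<Theta> t T p v s i = 0" if s: "s \<in> {t..T}" for s i
  proof -
    have flux: "(\<Sum>j\<in>nbrs \<omega> i. sqrt (\<omega> i j) * \<Theta> i j (p s) *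
        deriv (H i j) (graph_grad \<omega> (\<Phi> s) i j)) =
        (\<Sum>j\<in>nbrs \<omega> i. sqrt (\<omega> i j) * (v s i j * \<Theta> i j (p s)))"
      by (rule sum.cong[OF refl]) (simp add: v_eq[OF s] mult_ac)
    have pi: "((\<lambda>r. p r $ i) has_real_derivative p' s $ i) (at s within {t..T})"
      using p[OF s] by (simp add: has_vector_derivative_vec_iff)
    have unique: "((\<lambda>r. p r $ i) has_real_derivative d) (at s within {t..T}) \<longleftrightarrow> d = p' s $ i" for d
      using pi vector_derivative_within_closed_interval[OF tT s, of "\<lambda>r. p r $ i"]
      by (auto simp: has_real_derivative_iff_has_vector_derivative)
    show ?thesis
      unfolding flux continuity_residual_eq[OF s p[OF s]] unique by linarith
  qed
  have adjoint: "(\<forall>i. ((\<lambda>r. \<Phi> r $ i) has_real_derivative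
        - ((\<Sum>j\<in>nbrs \<omega> i. H i j (graph_grad \<omega> (\<Phi> s) i j) * partial_deriv i (\<Theta> i j) (p s)) +
           partial_deriv i F (p s))) (at s within {t..T})) \<longleftrightarrow>
      (\<Phi> has_vector_derivative - legendre_density_grad (\<Phi> s) (v s) (p s)) (at s within {t..T})"
    if s: "s \<in> {t..T}" for s
  proof -
    have "edge_gain (\<Phi> s) (v s) i j = H i j (graph_grad \<omega> (\<Phi> s) i j)" if "j \<in> nbrs \<omega> i" for i j
      using edge_gain_eq_iff[of i j "\<Phi> s" "v s"] v_eq[OF s that] that by (simp add: nbrs_def)
    then have "legendre_density_grad (\<Phi> s) (v s) (p s) $ i =
        (\<Sum>j\<in>nbrs \<omega> i. H i j (graph_grad \<omega> (\<Phi> s) i j) * partial_deriv i (\<Theta> i j) (p s)) +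
           partial_deriv i F (p s)" for i
      by (simp add: legendre_density_grad_component[OF pU[OF s] edge_gain_sym[OF v s]])
    then show ?thesis by (simp add: has_vector_derivative_vec_iff)
  qed
  have final: "(\<forall>i. \<Phi> T $ i = partial_deriv i G (p T)) \<longleftrightarrow> \<Phi> T = gradient G (p T)"
    by (simp add: vec_eq_iff gradient_def)
  show ?thesis
    unfolding hamiltonian_system_def
    by (intro arg_cong2[of _ _ _ _ "(\<and>)"] ball_cong all_cong1 flow adjoint final refl)
qed

theorem euler_lagrange_iff_hamiltonian_system:
  assumes p: "C1_curve t T p" and pU: "\<And>s. s \<in> {t..T} \<Longrightarrow> p s \<in> U"
    and v: "velocity_field \<omega> t T v" and \<Phi>: "continuous_on {t..T} \<Phi>"
  shows "euler_lagrange \<omega> \<Theta> L F G t T p0 p v \<Phi> \<longleftrightarrow>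
    hamiltonian_system \<omega> \<Theta> H F G t T p0 p \<Phi> \<and> feedback_control \<omega> H t T v \<Phi>"
proof -
  obtain p' where p'_ball: "\<forall>s\<in>{t..T}. (p has_vector_derivative p' s) (at s within {t..T})"
      and p'_cont: "continuous_on {t..T} p'"
    using p unfolding C1_curve_def by (elim exE conjE)
  note p' = bspec[OF p'_ball]
  have velocity: "stationary_velocity \<omega> \<Theta> L F G t T p v \<Phi> \<longleftrightarrow> feedback_control \<omega> H t T v \<Phi>"
    by (rule stationary_velocity_iff_feedback[OF p' p'_cont pU v \<Phi>])
  have density: "stationary_density \<omega> \<Theta> L F G t T p v \<Phi> \<longleftrightarrow>
      (\<forall>s\<in>{t..T}. (\<Phi> has_vector_derivative - legendre_density_grad (\<Phi> s) (v s) (p s))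
        (at s within {t..T})) \<and> \<Phi> T = gradient G (p T)"
    by (rule stationary_density_iff_adjoint[OF p' p'_cont pU v \<Phi>])
  have multiplier: "stationary_multiplier \<omega> \<Theta> L F G t T p v \<Phi> \<longleftrightarrow>
      (\<forall>s\<in>{t..T}. \<forall>i. continuity_residual \<omega> \<Theta> t T p v s i = 0)"
    by (rule stationary_multiplier_iff_continuity[OF p' p'_cont pU v \<Phi>])
  show ?thesis
  proof (cases "feedback_control \<omega> H t T v \<Phi>")
    case True
    have "hamiltonian_system \<omega> \<Theta> H F G t T p0 p \<Phi> \<longleftrightarrow>
        (\<forall>s\<in>{t..T}. \<forall>i. continuity_residual \<omega> \<Theta> t T p v s i = 0) \<and>
        (\<forall>s\<in>{t..T}. (\<Phi> has_vector_derivative - legendre_density_grad (\<Phi> s) (v s) (p s))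
          (at s within {t..T})) \<and> p t = p0 \<and> \<Phi> T = gradient G (p T)"
      by (rule hamiltonian_system_iff_under_feedback[OF p' pU v True])
    with True show ?thesis
      unfolding euler_lagrange_def velocity density multiplier by argo
  next
    case False
    then show ?thesis by (simp add: euler_lagrange_def velocity)
  qed
qed

text \<open>Admissibility contains the continuity equation, hence stationarity in the multiplier.\<close>

lemma euler_lagrange_of_admissible:
  assumes adm: "(p, v) \<in> admissible \<omega> \<Theta> t T p0" and pU: "\<And>s. s \<in> {t..T} \<Longrightarrow> p s \<in> U"
    and \<Phi>: "continuous_on {t..T} \<Phi>" and mult: "lagrange_multiplier \<omega> \<Theta> L F G t T p v \<Phi>"
  shows "euler_lagrange \<omega> \<Theta> L F G t T p0 p v \<Phi>"
proof -
  have p: "C1_curve t T p" and v: "velocity_field \<omega> t T v" and p0: "p t = p0"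
    and res: "\<forall>s\<in>{t..T}. \<forall>i. continuity_residual \<omega> \<Theta> t T p v s i = 0"
    using adm by (simp_all add: admissible_def simplex_curve_def)
  obtain p' where p'_ball: "\<forall>s\<in>{t..T}. (p has_vector_derivative p' s) (at s within {t..T})"
      and p'_cont: "continuous_on {t..T} p'"
    using p unfolding C1_curve_def by (elim exE conjE)
  have "stationary_multiplier \<omega> \<Theta> L F G t T p v \<Phi>"
    by (rule iffD2[OF stationary_multiplier_iff_continuity[OF bspec[OF p'_ball] p'_cont pU v \<Phi>] res])
  then show ?thesis
    using mult p0 by (simp add: euler_lagrange_def lagrange_multiplier_def)
qed

end

theorem proposition3p13:
  fixes Q :: "real^'n^'n" and \<pi> :: "real^'n"
    and \<theta> :: "real \<Rightarrow> real \<Rightarrow> real"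
    and L H :: "'n \<Rightarrow> 'n \<Rightarrow> real \<Rightarrow> real"
    and F G :: "real^'n \<Rightarrow> real"
    and \<omega> :: "'n \<Rightarrow> 'n \<Rightarrow> real" and \<Theta> :: "'n \<Rightarrow> 'n \<Rightarrow> real^'n \<Rightarrow> real"
    and t T :: real and p0 :: "real^'n"
    and p \<Phi> :: "real \<Rightarrow> real^'n" and v :: "real \<Rightarrow> 'n \<Rightarrow> 'n \<Rightarrow> real"
  assumes "reversible_chain Q \<pi>"
    and "activation \<theta>"
    and "\<omega> = weight Q \<pi>"
    and "\<Theta> = edge_activation \<theta> \<pi>"
    and "edge_lagrangians (edges \<omega>) L"
    and "H = (\<lambda>i j. convex_conjugate (L i j))"
    and "C1_simplex F" and "C1_simplex G"
    and "t < T" and "p0 \<in> prob_simplex"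
    and "simplex_curve t T p" and "\<forall>s\<in>{t..T}. \<forall>i. 0 < p s $ i"
    and "velocity_field \<omega> t T v"
    and "continuous_on {t..T} \<Phi>"
  shows "(\<forall>(i, j)\<in>edges \<omega>. \<forall>b. H i j field_differentiable at b) \<and>
    (euler_lagrange \<omega> \<Theta> L F G t T p0 p v \<Phi> \<longleftrightarrow>
       hamiltonian_system \<omega> \<Theta> H F G t T p0 p \<Phi> \<and> feedback_control \<omega> H t T v \<Phi>) \<and>
    (optimal \<omega> \<Theta> L F G t T p0 p v \<and> lagrange_multiplier \<omega> \<Theta> L F G t T p v \<Phi> \<longrightarrow>
       hamiltonian_system \<omega> \<Theta> H F G t T p0 p \<Phi> \<and> feedback_control \<omega> H t T v \<Phi>)"
proof -
  have \<omega>_sym: "\<omega> i j = \<omega> j i" for i j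
    using assms(1,3) by (simp add: reversible_chain_def weight_def)
  have \<pi>_pos: "0 < \<pi> $ i" for i
    using assms(1) by (simp add: reversible_chain_def positive_invariant_def)
  obtain UF UG where UF: "prob_simplex \<subseteq> UF" "C1_on UF F" and UG: "prob_simplex \<subseteq> UG" "C1_on UG G"
    using assms(7,8) by (auto simp: C1_simplex_def)
  \<comment> \<open>Positivity keeps away from the axes, where \<open>\<theta>\<close> need not be differentiable.\<close>
  define U where "U = {x :: real^'n. \<forall>i. 0 < x $ i} \<inter> UF \<inter> UG"
  have U: "open U" "U \<subseteq> UF" "U \<subseteq> UG"
    using UF(2) UG(2) unfolding U_def C1_on_def Collect_all_eq
    by (auto intro!: open_Int open_INT open_Collect_less continuous_intros)
  have scaled_pos: "0 < x $ i / \<pi> $ i" if "x \<in> U" for x i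
    using that \<pi>_pos[of i] by (simp add: U_def)
  have \<theta>_C1: "C1_on ({0<..} \<times> {0<..}) (\<lambda>(x, y). \<theta> x y)"
    using assms(2) by (simp add: activation_def)
  interpret graph_control_problem \<omega> \<Theta> L F G t T U
  proof
    fix x i j assume x: "x \<in> U"
    have "0 \<le> x $ k / \<pi> $ k" "x $ k / \<pi> $ k \<noteq> 0" for k
      using scaled_pos[OF x, of k] by linarith+
    then show "\<Theta> i j x = \<Theta> j i x" "0 < \<Theta> i j x"
      using assms(2) unfolding assms(4) edge_activation_def activation_def
      by (meson mult_eq_0_iff)+
  next
    fix i j
    have "C1_on U (\<lambda>x. (\<lambda>(x, y). \<theta> x y) (x $ i / \<pi> $ i, x $ j / \<pi> $ j))"
      by (rule C1_on_compose_linear[OF \<theta>_C1 _ U(1)])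
        (auto intro!: bounded_linear_Pair bounded_linear_compose[OF bounded_linear_divide]
          bounded_linear_vec_nth scaled_pos)
    then show "C1_on U (\<Theta> i j)"
      by (simp add: assms(4) edge_activation_def[abs_def])
  next
    fix k i j x h assume "k \<noteq> i" "k \<noteq> (j :: 'n)"
    then show "\<Theta> i j (x + h *\<^sub>R axis k 1) = \<Theta> i j x"
      by (simp add: assms(4) edge_activation_def axis_def)
  qed (use \<omega>_sym assms(5,9) C1_on_subset[OF UF(2) U(1,2)] C1_on_subset[OF UG(2) U(1,3)] in auto)
  have pU: "p s \<in> U" if "s \<in> {t..T}" for s
    using assms(11,12) UF(1) UG(1) that by (auto simp: simplex_curve_def U_def)
  have p: "C1_curve t T p" using assms(11) by (simp add: simplex_curve_def)
  have iff: "euler_lagrange \<omega> \<Theta> L F G t T p0 p v \<Phi> \<longleftrightarrow>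
      hamiltonian_system \<omega> \<Theta> H F G t T p0 p \<Phi> \<and> feedback_control \<omega> H t T v \<Phi>"
    unfolding assms(6)
    by (rule euler_lagrange_iff_hamiltonian_system[OF p pU assms(13,14)])
  moreover have "\<forall>(i, j)\<in>edges \<omega>. \<forall>b. H i j field_differentiable at b"
    unfolding assms(6) using L_edge(1,2) by (auto intro: convex_conjugate_differentiable)
  moreover have "optimal \<omega> \<Theta> L F G t T p0 p v \<and> lagrange_multiplier \<omega> \<Theta> L F G t T p v \<Phi> \<longrightarrow>
      hamiltonian_system \<omega> \<Theta> H F G t T p0 p \<Phi> \<and> feedback_control \<omega> H t T v \<Phi>"
  proof (intro impI, elim conjE)
    assume "optimal \<omega> \<Theta> L F G t T p0 p v" "lagrange_multiplier \<omega> \<Theta> L F G t T p v \<Phi>"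
    then have "euler_lagrange \<omega> \<Theta> L F G t T p0 p v \<Phi>"
      by (intro euler_lagrange_of_admissible pU assms(14)) (simp_all add: optimal_def)
    then show "hamiltonian_system \<omega> \<Theta> H F G t T p0 p \<Phi> \<and> feedback_control \<omega> H t T v \<Phi>"
      by (rule iffD1[OF iff])
  qed
  ultimately show ?thesis by (intro conjI)
qed

end
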